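(* Let $X$ be a dendric shift, on a finite alphabet $A$, generated by a primitive substitution. Then the skew product $G\rtimes_\varphi X$ is uniquely ergodic for every (monoid) morphism $\varphi\colon A^*\to G$ onto a finite group $G$.
   Context: A shift space on a finite alphabet $A$ is a nonempty closed subset $X\subseteq A^{\mathbb Z}$ invariant under the shift map $S((x_n)_n)=(x_{n+1})_n$, such that every letter of $A$ occurs in some element of $X$. Its language $\mathcal L(X)$ is the set of all finite words $x_ix_{i+1}\cdots x_{j-1}$ with $x\in X$, $i\le j$ (including the empty word). For $w\in\mathcal L(X)$, the extension graph $E(w)$ is the undirected bipartite graph whose vertex set is the disjoint union of $\{a\in A: aw\in\mathcal L(X)\}$ and $\{b\in A: wb\in\mathcal L(X)\}$, with an edge between left vertex $a$ and right vertex $b$ when $awb\in\mathcal L(X)$. $X$ is dendric if $E(w)$ is a tree for every $w\in\mathcal L(X)$. A substitution is a monoid endomorphism $\sigma\colon A^*\to A^*$; it is primitive if there is $n\ge1$ such that for all $a,b\in A$ the letter $b$ occurs in $\sigma^n(a)$; the shift generated by $\sigma$ is the set of $x\in A^{\mathbb Z}$ all of whose finite factors occur in some $\sigma^n(a)$, $n\ge0$, $a\in A$. The skew product $G\rtimes_\varphi X$ is the dynamical system $(G\times X,T_\varphi)$, $G$ discrete, with $T_\varphi(g,x)=(g\varphi(x_0),Sx)$; it is uniquely ergodic if it has exactly one $T_\varphi$-invariant Borel probability measure. *)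

theory Defs
  imports
    "HOL-Probability.Probability"
    "HOL-Algebra.Group"
    "HOL-Library.Sublist"
begin

text \<open>
  A graph is a pair of a vertex set and a set of edges, an edge being the two-element set of
  its endpoints.
\<close>

type_synonym 'v ugraph = "'v set \<times> 'v set set"

definition walk :: "'v ugraph \<Rightarrow> 'v list \<Rightarrow> bool" where
  "walk H p \<longleftrightarrow> p \<noteq> [] \<and> set p \<subseteq> fst H \<and> successively (\<lambda>u v. {u, v} \<in> snd H) p"

definition connected_graph :: "'v ugraph \<Rightarrow> bool" where
  "connected_graph H \<longleftrightarrow>
     fst H \<noteq> {} \<and> (\<forall>u\<in>fst H. \<forall>v\<in>fst H. \<exists>p. walk H p \<and> hd p = u \<and> last p = v)"

text \<open>A cycle is given by its vertices, each listed once; the edge from the last one back to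
  the first one closes it.\<close>

definition cycle :: "'v ugraph \<Rightarrow> 'v list \<Rightarrow> bool" where
  "cycle H p \<longleftrightarrow> walk H p \<and> distinct p \<and> 3 \<le> length p \<and> {last p, hd p} \<in> snd H"

definition tree :: "'v ugraph \<Rightarrow> bool" where
  "tree H \<longleftrightarrow> connected_graph H \<and> (\<nexists>p. cycle H p)"

text \<open>The alphabet is the finite type \<open>'a\<close>.\<close>

definition full_shift_topology :: "(int \<Rightarrow> 'a::finite) topology" where
  "full_shift_topology = product_topology (\<lambda>_. discrete_topology UNIV) UNIV"

definition shift_map :: "(int \<Rightarrow> 'a) \<Rightarrow> int \<Rightarrow> 'a" where
  "shift_map x = (\<lambda>n. x (n + 1))"

definition shift_space :: "(int \<Rightarrow> 'a::finite) set \<Rightarrow> bool" where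
  "shift_space X \<longleftrightarrow>
     X \<noteq> {} \<and> closedin full_shift_topology X \<and> shift_map ` X = X \<and> (\<forall>a. \<exists>x\<in>X. a \<in> range x)"

text \<open>The word \<open>x\<^sub>i \<dots> x\<^sub>j\<^sub>-\<^sub>1\<close>, empty for \<open>i = j\<close>.\<close>

definition factor :: "(int \<Rightarrow> 'a) \<Rightarrow> int \<Rightarrow> int \<Rightarrow> 'a list" where
  "factor x i j = map x [i..j - 1]"

definition lang :: "(int \<Rightarrow> 'a) set \<Rightarrow> 'a list set" where
  "lang X = {factor x i j | x i j. x \<in> X \<and> i \<le> j}"

definition extension_graph :: "(int \<Rightarrow> 'a) set \<Rightarrow> 'a list \<Rightarrow> ('a + 'a) ugraph" where
  "extension_graph X w =
     (Inl ` {a. [a] @ w \<in> lang X} \<union> Inr ` {b. w @ [b] \<in> lang X},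
      {{Inl a, Inr b} | a b. [a] @ w @ [b] \<in> lang X})"

definition dendric_shift :: "(int \<Rightarrow> 'a::finite) set \<Rightarrow> bool" where
  "dendric_shift X \<longleftrightarrow> shift_space X \<and> (\<forall>w\<in>lang X. tree (extension_graph X w))"

definition word_monoid :: "'a list monoid" where
  "word_monoid = \<lparr>carrier = UNIV, monoid.mult = (@), one = []\<rparr>"

definition monoid_morphism ::
  "('a, 'm) monoid_scheme \<Rightarrow> ('b, 'n) monoid_scheme \<Rightarrow> ('a \<Rightarrow> 'b) \<Rightarrow> bool" where
  "monoid_morphism M N h \<longleftrightarrow> h \<in> hom M N \<and> h \<one>\<^bsub>M\<^esub> = \<one>\<^bsub>N\<^esub>"

definition substitution :: "('a list \<Rightarrow> 'a list) \<Rightarrow> bool" where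
  "substitution \<sigma> \<longleftrightarrow> monoid_morphism word_monoid word_monoid \<sigma>"

definition primitive :: "('a list \<Rightarrow> 'a list) \<Rightarrow> bool" where
  "primitive \<sigma> \<longleftrightarrow> (\<exists>n\<ge>1. \<forall>a b. b \<in> set ((\<sigma> ^^ n) [a]))"

definition substitution_shift :: "('a list \<Rightarrow> 'a list) \<Rightarrow> (int \<Rightarrow> 'a) set" where
  "substitution_shift \<sigma> =
     {x. \<forall>i j. i \<le> j \<longrightarrow> (\<exists>n a. sublist (factor x i j) ((\<sigma> ^^ n) [a]))}"

definition borel_of :: "'b topology \<Rightarrow> 'b measure" where
  "borel_of \<tau> = sigma (topspace \<tau>) {U. openin \<tau> U}"

definition invariant_prob :: "'b topology \<Rightarrow> ('b \<Rightarrow> 'b) \<Rightarrow> 'b measure \<Rightarrow> bool" where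
  "invariant_prob \<tau> T \<mu> \<longleftrightarrow>
     sets \<mu> = sets (borel_of \<tau>) \<and> prob_space \<mu> \<and>
     T \<in> measurable \<mu> \<mu> \<and> (\<forall>B\<in>sets \<mu>. emeasure \<mu> (T -` B \<inter> space \<mu>) = emeasure \<mu> B)"

definition uniquely_ergodic :: "'b topology \<Rightarrow> ('b \<Rightarrow> 'b) \<Rightarrow> bool" where
  "uniquely_ergodic \<tau> T \<longleftrightarrow> (\<exists>!\<mu>. invariant_prob \<tau> T \<mu>)"

definition skew_topology ::
  "('g, 'm) monoid_scheme \<Rightarrow> (int \<Rightarrow> 'a::finite) set \<Rightarrow> ('g \<times> (int \<Rightarrow> 'a)) topology" where
  "skew_topology G X =
     prod_topology (discrete_topology (carrier G)) (subtopology full_shift_topology X)"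

definition skew_map ::
  "('g, 'm) monoid_scheme \<Rightarrow> ('a list \<Rightarrow> 'g) \<Rightarrow> 'g \<times> (int \<Rightarrow> 'a) \<Rightarrow> 'g \<times> (int \<Rightarrow> 'a)" where
  "skew_map G \<phi> = (\<lambda>(g, x). (g \<otimes>\<^bsub>G\<^esub> \<phi> [x 0], shift_map x))"

end

theory Submission
  imports Defs
begin

text \<open>
  A primitive substitution shift is linearly recurrent: a word of length \<open>n\<close> occurs in every word
  of length \<open>K n\<close>. Linear recurrence lifts to the skew product. Given \<open>v\<close>, start with \<open>W = v\<close>
  and let \<open>P\<close> be the set of group elements \<open>\<phi>(p)\<close> for the occurrences \<open>W = p v s\<close>. Passing
  from \<open>W\<close> to \<open>r W\<close>, where \<open>r\<close> is a return word to \<open>W\<close>, enlarges \<open>P\<close> unless \<open>\<phi>(r) P = P\<close>.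
  If all return words fix \<open>P\<close>, translating \<open>P\<close> along an orbit to the next occurrence of \<open>W\<close>
  gives a locally constant equivariant function from the shift to the subsets of \<open>G\<close>; connectedness
  of the extension graphs lowers the number of letters it depends on, one by one, down to none, so
  it is a constant \<open>G\<close>-invariant subset and \<open>P = G\<close>. Hence at most \<open>|G|\<close> steps lead to \<open>P = G\<close>,
  with \<open>W\<close> of length linear in that of \<open>v\<close>.

  In a linearly recurrent system the maximal and minimal Birkhoff sums of length \<open>n\<close> of a set
  depending on finitely many coordinates have the same growth rate, since each stretch of length
  \<open>K n\<close> contains a stretch with the minimal sum. So all averages converge to the same limit. The
  limits form a finitely additive measure on clopen sets, which extends to an invariant measure by
  compactness, and every invariant measure agrees with it by dominated convergence.
\<close>

section \<open>Birkhoff averages\<close>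

definition birkhoff_sum :: "('b \<Rightarrow> 'b) \<Rightarrow> ('b \<Rightarrow> real) \<Rightarrow> nat \<Rightarrow> 'b \<Rightarrow> real" where
  "birkhoff_sum T f n y = (\<Sum>i<n. f ((T ^^ i) y))"

lemma birkhoff_sum_add:
  "birkhoff_sum T f (m + n) y = birkhoff_sum T f m y + birkhoff_sum T f n ((T ^^ m) y)"
proof (induction n)
  case 0
  then show ?case by (simp add: birkhoff_sum_def)
next
  case (Suc n)
  have "(T ^^ (m + n)) y = (T ^^ n) ((T ^^ m) y)"
    by (metis add.commute comp_apply funpow_add)
  with Suc show ?case by (simp add: birkhoff_sum_def)
qed

lemma funpow_closed: "T \<in> Y \<rightarrow> Y \<Longrightarrow> y \<in> Y \<Longrightarrow> (T ^^ n) y \<in> Y"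
  by (induction n) auto

text \<open>The upper bound follows Fekete's lemma: the suprema \<open>M n\<close> are subadditive,
  so \<open>M n / n\<close> tends to its infimum \<open>b\<close>. For the lower bound, every orbit
  stretch of length \<open>(K + 1) * n\<close> contains \<open>n\<close> steps with the same sum as
  at \<open>z\<close>, so a small sum at \<open>z\<close> would push \<open>M ((K + 1) * n)\<close>
  below \<open>b * (K + 1) * n\<close>.\<close>

lemma birkhoff_averages_converge:
  fixes T :: "'b \<Rightarrow> 'b" and f :: "'b \<Rightarrow> real"
  assumes T: "T \<in> Y \<rightarrow> Y" and ne: "Y \<noteq> {}"
    and f: "\<And>y. y \<in> Y \<Longrightarrow> 0 \<le> f y" "\<And>y. y \<in> Y \<Longrightarrow> f y \<le> 1"
    and rec: "\<And>n y z. n \<ge> n0 \<Longrightarrow> y \<in> Y \<Longrightarrow> z \<in> Y \<Longrightarrow>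
      \<exists>i\<le>K * n. birkhoff_sum T f n ((T ^^ i) y) = birkhoff_sum T f n z"
  shows "\<exists>c. \<forall>y\<in>Y. (\<lambda>n. birkhoff_sum T f n y / n) \<longlonglongrightarrow> c"
proof -
  let ?B = "birkhoff_sum T f"
  define M where "M n = (SUP y\<in>Y. ?B n y)" for n
  have B: "0 \<le> ?B n y" "?B n y \<le> n" if "y \<in> Y" for n y
    using sum_bounded_above[of "{..<n}" "\<lambda>i. f ((T ^^ i) y)" 1] f funpow_closed[OF T that]
    by (auto simp: birkhoff_sum_def intro!: sum_nonneg)
  have bdd: "bdd_above (?B n ` Y)" for n
    by (rule bdd_aboveI2[OF B(2)])
  have BM: "?B n y \<le> M n" if "y \<in> Y" for n y
    unfolding M_def using bdd that by (rule cSUP_upper2) simp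
  have MI: "M n \<le> r" if "\<And>y. y \<in> Y \<Longrightarrow> ?B n y \<le> r" for n r
    unfolding M_def using ne that by (rule cSUP_least)
  have Mn: "M n \<le> n" for n
    by (rule MI) (rule B)
  have M0: "0 \<le> M n" for n
    using ne B(1) BM by (meson all_not_in_conv order_trans)
  have sub: "M (m + n) \<le> M m + M n" for m n
    by (rule MI) (simp add: birkhoff_sum_add add_mono BM funpow_closed[OF T])
  have sub_mult: "M (q * n) \<le> q * M n" for q n
  proof (induction q)
    case 0
    then show ?case using Mn[of 0] by simp
  next
    case (Suc q)
    then show ?case using sub[of n "q * n"] by (simp add: algebra_simps)
  qed
  define b where "b = (INF n\<in>{1..}. M n / real n)"
  have b_le: "b * n \<le> M n" for n
  proof (cases "n = 0")
    case True
    then show ?thesis using M0 by simp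
  next
    case False
    then have "b \<le> M n / n"
      unfolding b_def by (intro cINF_lower bdd_belowI2[where m = 0]) (auto simp: M0)
    then show ?thesis using False by (simp add: field_simps)
  qed
  have b0: "0 \<le> b"
    unfolding b_def by (rule cINF_greatest) (auto simp: M0)
  \<comment> \<open>Choose \<open>n\<close> with \<open>M n / n\<close> below \<open>b + e\<close>
    and divide \<open>l\<close> by \<open>n\<close>; the remainder costs at most the constant
    \<open>C = n\<close>.\<close>
  have upper: "\<exists>C\<ge>0. \<forall>l. M l \<le> (b + e) * l + C" if "e > 0" for e
  proof -
    have "\<exists>n\<in>{1..}. M n / real n < b + e"
      by (rule cInf_lessD[of "(\<lambda>n. M n / real n) ` {1..}", simplified image_iff, THEN bexE])
        (use that in \<open>auto simp: b_def\<close>)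
    then obtain n where n: "n \<ge> 1" "M n \<le> (b + e) * n"
      by (fastforce simp: field_simps)
    have "M l \<le> (b + e) * l + n" for l
    proof -
      have "M l \<le> M (l div n * n) + M (l mod n)"
        using sub[of "l div n * n" "l mod n"] by simp
      also have "\<dots> \<le> (l div n) * M n + n"
      proof -
        have "l mod n \<le> n" using n(1) by (simp add: less_imp_le)
        then show ?thesis
          using sub_mult[of "l div n" n] Mn[of "l mod n"] by linarith
      qed
      also have "\<dots> \<le> (l div n) * ((b + e) * n) + n"
        using n(2) by (simp add: mult_left_mono)
      also have "(l div n) * ((b + e) * n) = (b + e) * real (l div n * n)"
        by simp
      also have "\<dots> \<le> (b + e) * l"
        using b0 that by (intro mult_left_mono of_nat_mono) auto
      finally show ?thesis by simp
    qed
    then show ?thesis by (intro exI[of _ "real n"]) auto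
  qed
  have "(\<lambda>n. ?B n z / n) \<longlonglongrightarrow> b" if z: "z \<in> Y" for z
  proof (rule LIMSEQ_I)
    fix r :: real assume r: "0 < r"
    \<comment> \<open>The deviation from \<open>b * n\<close> is at most
      \<open>e * (K + 1) * n + 2 * C\<close>. This \<open>e\<close> turns the first term into
      \<open>r / 2 * n\<close>, and \<open>N > 4 * C / r\<close> keeps the second below
      \<open>r / 2 * n\<close>.\<close>
    define e where "e = r / (2 * (K + 1))"
    have e: "e > 0" using r by (simp add: e_def)
    obtain C where C: "C \<ge> 0" "\<And>l. M l \<le> (b + e) * l + C"
      using upper[OF e] by blast
    obtain N :: nat where N: "4 * C / r < N" using reals_Archimedean2 by blast
    have "norm (?B n z / n - b) < r" if n: "n \<ge> max (max n0 1) N" for n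
    proof -
      have n1: "n \<ge> 1" "n \<ge> n0" "real n \<ge> N" using n by auto
      \<comment> \<open>A stretch of this length splits into \<open>i\<close> steps, then
        \<open>n\<close> steps with the sum found at \<open>z\<close>, then \<open>k\<close> steps;
        only the outer parts are estimated through \<open>M\<close>.\<close>
      have "b * real ((K + 1) * n) \<le> M ((K + 1) * n)" by (rule b_le)
      also have "\<dots> \<le> (b + e) * (K * n) + 2 * C + ?B n z"
      proof (rule MI)
        fix y assume y: "y \<in> Y"
        obtain i where i: "i \<le> K * n" "?B n ((T ^^ i) y) = ?B n z"
          using rec[OF n1(2) y z] by blast
        define k where "k = K * n - i"
        have k: "(K + 1) * n = i + n + k" and ik: "K * n = i + k"
          using i(1) by (auto simp: k_def)
        have "?B ((K + 1) * n) y = ?B i y + ?B n ((T ^^ i) y) + ?B k ((T ^^ (i + n)) y)"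
          unfolding k by (simp only: birkhoff_sum_add)
        also have "\<dots> \<le> M i + ?B n z + M k"
          using BM i(2) funpow_closed[OF T y] y by (metis add_mono add_right_mono)
        also have "\<dots> \<le> ((b + e) * i + C) + ?B n z + ((b + e) * k + C)"
          using C(2)[of i] C(2)[of k] by linarith
        also have "\<dots> = (b + e) * real (i + k) + 2 * C + ?B n z"
          by (simp add: algebra_simps)
        finally show "?B ((K + 1) * n) y \<le> (b + e) * real (K * n) + 2 * C + ?B n z"
          unfolding ik .
      qed
      finally have lo: "b * n - e * K * n - 2 * C \<le> ?B n z"
        by (simp add: algebra_simps)
      have hi: "?B n z \<le> b * n + e * n + C"
        using BM[OF z, of n] C(2)[of n] by (simp add: algebra_simps)
      have Cn: "2 * C < r / 2 * n"
      proof -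
        have "4 * C / r < n" using N n1(3) by linarith
        then show ?thesis using r by (simp add: field_simps)
      qed
      have "real K + 1 \<noteq> 0" by linarith
      then have "e * (K + 1) = r / 2"
        unfolding e_def by (simp add: divide_simps)
      then have "e * (K + 1) * n = r / 2 * n" by (simp only:)
      then have K: "e * K * n + e * n = r / 2 * n" by (simp add: algebra_simps)
      have "0 \<le> e * n" "0 \<le> e * K * n" using e by auto
      then have "\<bar>?B n z - b * n\<bar> < r * n"
        using lo hi Cn K C(1) by (simp add: abs_less_iff)
      moreover have "?B n z / n - b = (?B n z - b * n) / n"
        using n1 by (simp add: field_simps)
      ultimately show ?thesis
        using n1 by (simp add: divide_less_eq)
    qed
    then show "\<exists>no. \<forall>n\<ge>no. norm (?B n z / n - b) < r" by blast
  qed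
  then show ?thesis by blast
qed

lemma average_preimage:
  assumes T: "T \<in> Y \<rightarrow> Y" and y: "y \<in> Y"
    and lim: "\<And>y. y \<in> Y \<Longrightarrow> (\<lambda>n. birkhoff_sum T (indicator C) n y / n) \<longlonglongrightarrow> c"
  shows "(\<lambda>n. birkhoff_sum T (indicator (T -` C \<inter> Y)) n y / n) \<longlonglongrightarrow> c"
proof -
  have "birkhoff_sum T (indicator (T -` C \<inter> Y)) n y = birkhoff_sum T (indicator C) n (T y)" for n
    unfolding birkhoff_sum_def
  proof (intro sum.cong refl)
    fix i
    show "indicator (T -` C \<inter> Y) ((T ^^ i) y) = (indicator C ((T ^^ i) (T y)) :: real)"
      using funpow_closed[OF T y, of i] by (simp add: indicator_def funpow_swap1)
  qed
  then show ?thesis using lim[of "T y"] T y by auto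
qed

text \<open>Invariance makes every average of positive length integrate to
  \<open>measure \<mu> C\<close>; dominated convergence with bound \<open>1\<close> makes these
  integrals tend to \<open>c\<close>.\<close>

lemma invariant_prob_eq_limit:
  assumes \<mu>: "invariant_prob \<tau> T \<mu>" and sp: "topspace \<tau> = Y" and C: "C \<in> sets \<mu>"
    and lim: "\<And>y. y \<in> Y \<Longrightarrow> (\<lambda>n. birkhoff_sum T (indicator C) n y / n) \<longlonglongrightarrow> c"
  shows "emeasure \<mu> C = ennreal c"
proof -
  from \<mu> interpret prob_space \<mu> by (simp add: invariant_prob_def)
  have Tm[measurable]: "T \<in> measurable \<mu> \<mu>"
    and inv: "\<And>B. B \<in> sets \<mu> \<Longrightarrow> emeasure \<mu> (T -` B \<inter> space \<mu>) = emeasure \<mu> B"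
    and sets: "sets \<mu> = sets (borel_of \<tau>)"
    using \<mu> by (auto simp: invariant_prob_def)
  have sp': "space \<mu> = Y"
    using sets_eq_imp_space_eq[OF sets] sp
    by (simp add: borel_of_def space_measure_of_conv)
  have Tn[measurable]: "T ^^ i \<in> measurable \<mu> \<mu>" for i
    by (rule measurable_compose_n) (rule Tm)
  have invn: "emeasure \<mu> ((T ^^ i) -` C \<inter> space \<mu>) = emeasure \<mu> C" for i
  proof (induction i)
    case 0
    then show ?case using sets.sets_into_space[OF C] by (simp add: Int_absorb2)
  next
    case (Suc i)
    have "(T ^^ Suc i) -` C \<inter> space \<mu> = T -` ((T ^^ i) -` C \<inter> space \<mu>) \<inter> space \<mu>"
      using measurable_space[OF Tm] by (auto simp: funpow_swap1)
    then show ?case using Suc inv[OF measurable_sets[OF Tn C], of i] by (simp only:)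
  qed
  note [measurable] = C
  have int: "integrable \<mu> (\<lambda>y. indicator C ((T ^^ i) y) :: real)" for i
    by (rule integrable_const_bound[where B = 1]) (auto simp: indicator_def)
  have eq: "(\<integral>y. indicator C ((T ^^ i) y) \<partial>\<mu>) = measure \<mu> C" for i
  proof -
    have "(\<integral>y. indicator C ((T ^^ i) y) \<partial>\<mu>)
        = (\<integral>y. (indicator ((T ^^ i) -` C \<inter> space \<mu>) y :: real) \<partial>\<mu>)"
      by (rule Bochner_Integration.integral_cong) (auto simp: indicator_def)
    then show ?thesis
      using invn[of i] by (simp add: measure_def)
  qed
  \<comment> \<open>At \<open>n = 0\<close> the quotient is \<open>0\<close> by the convention for
    division, so only positive \<open>n\<close> satisfy this.\<close>
  have I: "(\<integral>y. birkhoff_sum T (indicator C) n y / n \<partial>\<mu>) = measure \<mu> C" if "n > 0" for n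
    using that by (simp add: birkhoff_sum_def int eq)
  have "(\<lambda>n. \<integral>y. birkhoff_sum T (indicator C) n y / n \<partial>\<mu>) \<longlonglongrightarrow> (\<integral>y. c \<partial>\<mu>)"
  proof (rule integral_dominated_convergence[where w = "\<lambda>_. 1"])
    show "(\<lambda>y. birkhoff_sum T (indicator C) n y / n) \<in> borel_measurable \<mu>" for n
      unfolding birkhoff_sum_def by measurable
    show "AE y in \<mu>. (\<lambda>n. birkhoff_sum T (indicator C) n y / n) \<longlonglongrightarrow> c"
      using lim by (intro AE_I2) (simp add: sp')
    show "AE y in \<mu>. norm (birkhoff_sum T (indicator C) n y / real n) \<le> 1" for n
    proof (rule AE_I2)
      fix y
      have "birkhoff_sum T (indicator C) n y \<le> n" "0 \<le> birkhoff_sum T (indicator C) n y"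
        using sum_bounded_above[of "{..<n}" "\<lambda>i. indicator C ((T ^^ i) y)" "1::real"]
        by (auto simp: birkhoff_sum_def indicator_def intro!: sum_nonneg)
      then show "norm (birkhoff_sum T (indicator C) n y / real n) \<le> 1"
        by (auto simp: divide_le_eq_1)
    qed
  qed auto
  moreover have "(\<lambda>n. \<integral>y. birkhoff_sum T (indicator C) n y / n \<partial>\<mu>) \<longlonglongrightarrow> measure \<mu> C"
    by (rule tendsto_eventually) (use I in \<open>auto intro!: eventually_sequentiallyI[of 1]\<close>)
  ultimately have "measure \<mu> C = c"
    using LIMSEQ_unique by (fastforce simp: prob_space)
  then show ?thesis by (simp add: emeasure_eq_measure)
qed

text \<open>Existence: the limits \<open>m\<close> are finitely additive on \<open>\<A>\<close> and
  extend by Caratheodory's theorem. Uniqueness: every invariant measure takes the values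
  \<open>m\<close> on the intersection-stable generator \<open>\<A>\<close>.\<close>

lemma uniquely_ergodicI:
  fixes \<tau> :: "'b topology" and T :: "'b \<Rightarrow> 'b"
  assumes alg: "algebra Y \<A>" and comp: "compact_space \<tau>" and sp: "topspace \<tau> = Y"
    and borel: "sets (borel_of \<tau>) = sigma_sets Y \<A>"
    and clo: "\<And>C. C \<in> \<A> \<Longrightarrow> closedin \<tau> C"
    and T: "T \<in> Y \<rightarrow> Y" and ne: "Y \<noteq> {}"
    and pre: "\<And>C. C \<in> \<A> \<Longrightarrow> T -` C \<inter> Y \<in> \<A>"
    and lim: "\<And>C. C \<in> \<A> \<Longrightarrow> \<exists>c. \<forall>y\<in>Y. (\<lambda>n. birkhoff_sum T (indicator C) n y / n) \<longlonglongrightarrow> c"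
  shows "uniquely_ergodic \<tau> T"
proof -
  interpret algebra Y \<A> by (rule alg)
  obtain y0 where y0: "y0 \<in> Y" using ne by blast
  obtain m where m: "\<And>C y. C \<in> \<A> \<Longrightarrow> y \<in> Y \<Longrightarrow>
      (\<lambda>n. birkhoff_sum T (indicator C) n y / n) \<longlonglongrightarrow> m C"
    using lim by metis
  \<comment> \<open>The limits do not depend on the point, so all properties of \<open>m\<close> can
    be tested at \<open>y0\<close>.\<close>
  have m_eq: "m C = c"
    if "C \<in> \<A>" "(\<lambda>n. birkhoff_sum T (indicator C) n y0 / n) \<longlonglongrightarrow> c" for C c
    using m[OF that(1) y0] that(2) by (rule LIMSEQ_unique)
  have m0: "0 \<le> m C" if "C \<in> \<A>" for C
    by (rule LIMSEQ_le_const[OF m[OF that y0]])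
      (auto simp: birkhoff_sum_def indicator_def intro!: sum_nonneg)
  have m_empty: "m {} = 0"
    by (rule m_eq) (auto simp: birkhoff_sum_def)
  have m_Y: "m Y = 1"
  proof (rule m_eq)
    have "birkhoff_sum T (indicator Y) n y0 / n = 1" if "n \<ge> 1" for n
      using funpow_closed[OF T y0] that by (simp add: birkhoff_sum_def)
    then show "(\<lambda>n. birkhoff_sum T (indicator Y) n y0 / n) \<longlonglongrightarrow> 1"
      by (intro tendsto_eventually eventually_sequentiallyI[of 1])
  qed auto
  have m_add: "m (C \<union> D) = m C + m D" if CD: "C \<in> \<A>" "D \<in> \<A>" "C \<inter> D = {}" for C D
  proof (rule m_eq)
    have "indicator (C \<union> D) y = indicator C y + (indicator D y :: real)" for y
      using CD(3) by (auto simp: indicator_def)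
    then have "birkhoff_sum T (indicator (C \<union> D)) n y0 / n
        = birkhoff_sum T (indicator C) n y0 / n + birkhoff_sum T (indicator D) n y0 / n" for n
      by (simp add: birkhoff_sum_def sum.distrib add_divide_distrib)
    then show "(\<lambda>n. birkhoff_sum T (indicator (C \<union> D)) n y0 / n) \<longlonglongrightarrow> m C + m D"
      using tendsto_add[OF m[OF CD(1) y0] m[OF CD(2) y0]] by simp
  qed (use CD in auto)
  have m_pre: "m (T -` C \<inter> Y) = m C" if "C \<in> \<A>" for C
    by (intro m_eq pre that average_preimage[OF T y0] m)
  have "\<exists>\<mu> :: 'b set \<Rightarrow> ennreal. (\<forall>s\<in>\<A>. \<mu> s = ennreal (m s)) \<and> measure_space Y (sigma_sets Y \<A>) \<mu>"
  proof (rule caratheodory_empty_continuous)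
    show "positive \<A> (\<lambda>C. ennreal (m C))"
      by (simp add: positive_def m_empty)
    show "additive \<A> (\<lambda>C. ennreal (m C))"
      by (auto simp: additive_def m_add m0)
    fix A :: "nat \<Rightarrow> 'b set"
    assume A: "range A \<subseteq> \<A>" "decseq A" "(\<Inter>i. A i) = {}"
    \<comment> \<open>Compactness makes a decreasing sequence of closed sets with empty intersection
      eventually empty, so countable additivity is automatic.\<close>
    have "\<exists>i. A i = {}"
    proof (rule ccontr)
      assume "\<not> ?thesis"
      then have "(\<Inter>i. A i) \<noteq> {}"
        using A by (intro compact_space_imp_nest[OF comp] clo) auto
      with A(3) show False by simp
    qed
    then obtain i where "A i = {}" ..
    then have "ennreal (m (A j)) = 0" if "j \<ge> i" for j
      using decseqD[OF A(2) that] m_empty by simp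
    then show "(\<lambda>i. ennreal (m (A i))) \<longlonglongrightarrow> 0"
      by (intro tendsto_eventually eventually_sequentiallyI[of i])
  qed auto
  then obtain \<mu>0 where \<mu>0: "\<And>C. C \<in> \<A> \<Longrightarrow> \<mu>0 C = ennreal (m C)"
    "measure_space Y (sigma_sets Y \<A>) \<mu>0" by blast
  define \<mu> where "\<mu> = measure_of Y \<A> \<mu>0"
  have sets: "sets \<mu> = sigma_sets Y \<A>" and space: "space \<mu> = Y"
    using space_closed by (auto simp: \<mu>_def)
  have em: "emeasure \<mu> C = \<mu>0 C" if "C \<in> sigma_sets Y \<A>" for C
    using \<mu>0(2) that space_closed unfolding measure_space_def
    by (intro emeasure_measure_of[OF \<mu>_def]) (auto simp: sets)
  have emA: "emeasure \<mu> C = ennreal (m C)" if "C \<in> \<A>" for C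
    using em[of C] \<mu>0(1)[OF that] that by auto
  interpret \<mu>: prob_space \<mu>
    by (rule prob_spaceI) (simp add: space emA m_Y)
  have Tm[measurable]: "T \<in> measurable \<mu> \<mu>"
    by (rule measurable_sigma_sets[OF sets space_closed]) (use T pre space sets in auto)
  \<comment> \<open>Invariance on \<open>\<A>\<close> spreads to the generated sigma-algebra because
    \<open>\<A>\<close> is stable under intersections.\<close>
  have "distr \<mu> \<mu> T = \<mu>"
  proof (rule measure_eqI_generator_eq[where E = \<A> and \<Omega> = Y and A = "\<lambda>_. Y"])
    show "Int_stable \<A>" by (rule Int_stable)
    show "emeasure (distr \<mu> \<mu> T) C = emeasure \<mu> C" if "C \<in> \<A>" for C
      using that by (simp add: emeasure_distr sets space emA pre m_pre)
    show "emeasure (distr \<mu> \<mu> T) Y \<noteq> \<infinity>"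
      by (subst emeasure_distr[OF Tm]) (use sets in auto)
  qed (use sets space_closed in auto)
  then have "emeasure \<mu> (T -` B \<inter> space \<mu>) = emeasure \<mu> B" if "B \<in> sets \<mu>" for B
    using emeasure_distr[OF Tm that] by simp
  then have inv: "invariant_prob \<tau> T \<mu>"
    unfolding invariant_prob_def using sets borel \<mu>.prob_space_axioms Tm by simp
  show ?thesis
    unfolding uniquely_ergodic_def
  proof (intro ex1I[of _ \<mu>])
    show "invariant_prob \<tau> T \<mu>" by (rule inv)
  next
    fix \<nu> assume \<nu>: "invariant_prob \<tau> T \<nu>"
    have sets': "sets \<nu> = sigma_sets Y \<A>" using \<nu> borel by (simp add: invariant_prob_def)
    have eq: "emeasure \<nu> C = emeasure \<mu> C" if "C \<in> \<A>" for C
      using invariant_prob_eq_limit[OF \<nu> sp _ m[OF that]] that by (simp add: sets' emA)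
    show "\<nu> = \<mu>"
      by (rule measure_eqI_generator_eq[where E = \<A> and \<Omega> = Y and A = "\<lambda>_. Y"])
        (use Int_stable space_closed eq sets sets' emA in auto)
  qed
qed

section \<open>Linear recurrence of primitive substitutions\<close>

text \<open>A word no longer than any block crosses at most one boundary between blocks, so it meets
  at most two consecutive ones.\<close>

lemma sublist_concat_map_short:
  assumes "sublist u (concat (map f y))" "u \<noteq> []" "\<And>a. length u \<le> length (f a)"
  shows "\<exists>d. length d \<le> 2 \<and> sublist d y \<and> sublist u (concat (map f d))"
  using assms(1)
proof (induction y)
  case Nil
  then show ?case using assms(2) by simp
next
  case (Cons a y)
  then consider "sublist u (f a)" | "sublist u (concat (map f y))"
    | u1 u2 where "u = u1 @ u2" "suffix u1 (f a)" "prefix u2 (concat (map f y))"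
    by (auto simp: sublist_append)
  then show ?case
  proof cases
    case 1
    then show ?thesis by (intro exI[of _ "[a]"]) (auto simp: sublist_def)
  next
    case 2
    then show ?thesis using Cons.IH by (metis sublist_Cons_right)
  next
    case 3
    show ?thesis
    proof (cases y)
      case Nil
      then have "u2 = []" using 3(3) by simp
      with 3 show ?thesis
        by (intro exI[of _ "[a]"]) (simp add: suffix_imp_sublist Nil)
    next
      case (Cons b z)
      have "prefix u2 (f b)"
        using 3(1,3) assms(3)[of b] Cons by (intro prefix_length_prefix[OF 3(3)]) auto
      then have "sublist u (f a @ f b)"
        using 3(1,2) by (auto simp: sublist_append)
      moreover have "sublist [a, b] (a # y)"
        unfolding sublist_def Cons by (intro exI[of _ "[]"] exI[of _ z]) simp
      ultimately show ?thesis by (intro exI[of _ "[a, b]"]) auto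
    qed
  qed
qed

text \<open>The first block boundary inside \<open>v\<close> comes after at most \<open>M\<close>
  letters, and the \<open>M\<close> or more letters that follow cover the next block.\<close>

lemma sublist_concat_map_long:
  assumes "sublist v (concat (map f y))" "\<And>a. length (f a) \<le> M" "2 * M \<le> length v" "1 \<le> M"
  shows "\<exists>a. sublist (f a) v"
  using assms(1)
proof (induction y)
  case Nil
  then show ?case using assms(3,4) by auto
next
  case (Cons a y)
  then consider "sublist v (f a)" | "sublist v (concat (map f y))"
    | u1 u2 where "v = u1 @ u2" "suffix u1 (f a)" "prefix u2 (concat (map f y))"
    by (auto simp: sublist_append)
  then show ?case
  proof cases
    case 1
    then show ?thesis using assms(2)[of a] assms(3,4) sublist_length_le[OF 1] by linarith
  next
    case 2
    then show ?thesis using Cons.IH by blast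
  next
    case 3
    have "length u1 \<le> M" using suffix_length_le[OF 3(2)] assms(2)[of a] by linarith
    then have u2: "M \<le> length u2" using 3(1) assms(3) by simp
    then have "y \<noteq> []" using 3(3) assms(4) by auto
    then obtain b z where y: "y = b # z" by (cases y) auto
    have "prefix (f b) u2"
      using 3(3) u2 assms(2)[of b] y by (intro prefix_length_prefix[OF _ 3(3)]) auto
    then show ?thesis using 3(1) by (metis prefix_imp_sublist sublist_append_leftI sublist_order.order_trans)
  qed
qed

text \<open>\<open>growing\<close> excludes the identity on a one-letter alphabet, which is
  primitive but whose iterates stay bounded.\<close>

locale growing_primitive_substitution =
  fixes \<sigma> :: "'a::finite list \<Rightarrow> 'a list" and p :: nat
  assumes morph: "\<sigma> (u @ v) = \<sigma> u @ \<sigma> v" and Nil: "\<sigma> [] = []"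
    and p1: "p \<ge> 1" and occ: "b \<in> set ((\<sigma> ^^ p) [a])"
    and growing: "\<exists>n a. length ((\<sigma> ^^ n) [a]) \<ge> k"
begin

lemma pow_append: "(\<sigma> ^^ n) (u @ v) = (\<sigma> ^^ n) u @ (\<sigma> ^^ n) v"
  by (induction n) (auto simp: morph)

lemma pow_Nil: "(\<sigma> ^^ n) [] = []"
  by (induction n) (auto simp: Nil)

lemma pow_add: "(\<sigma> ^^ (m + n)) u = (\<sigma> ^^ m) ((\<sigma> ^^ n) u)"
  by (simp add: funpow_add)

lemma pow_concat: "(\<sigma> ^^ n) u = concat (map (\<lambda>a. (\<sigma> ^^ n) [a]) u)"
proof (induction u)
  case (Cons a u)
  then show ?case using pow_append[of n "[a]" u] by simp
qed (simp add: pow_Nil)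

lemma pow_sublist: "sublist u v \<Longrightarrow> sublist ((\<sigma> ^^ n) u) ((\<sigma> ^^ n) v)"
  unfolding sublist_def by (metis pow_append)

lemma sublist_pow_letter: "sublist [b] ((\<sigma> ^^ p) [a])"
  using occ[of b a] split_list[of b] by (fastforce simp: sublist_def)

lemma length_pow_ge: "length u \<le> length ((\<sigma> ^^ n) u)"
proof -
  have "\<sigma> [a] \<noteq> []" for a
  proof
    assume "\<sigma> [a] = []"
    then have "(\<sigma> ^^ (p - 1 + 1)) [a] = []"
      unfolding pow_add by (simp add: pow_Nil)
    then show False using occ[of a a] p1 by simp
  qed
  then have 1: "length u \<le> length (\<sigma> u)" for u
  proof (induction u)
    case (Cons a u)
    have "\<sigma> (a # u) = \<sigma> [a] @ \<sigma> u" using morph[of "[a]" u] by simp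
    moreover have "1 \<le> length (\<sigma> [a])" using Cons.prems[of a] by (simp add: Suc_leI)
    ultimately show ?case using Cons by simp
  qed simp
  show ?thesis
    by (induction n) (auto intro: order_trans[OF _ 1])
qed

text \<open>Since \<open>a\<close> occurs in the \<open>p\<close>-th image of every letter,
  \<open>u\<close> occurs in the image under exponent \<open>m + p\<close> of every letter
  \<open>d\<close>. For larger \<open>j\<close>, take \<open>d\<close> to be the first letter of the
  image of \<open>c\<close> under the surplus exponent.\<close>

lemma sublist_pow_eventually:
  assumes "sublist u ((\<sigma> ^^ m) [a])" "m + p \<le> j"
  shows "sublist u ((\<sigma> ^^ j) [c])"
proof -
  obtain i where j: "j = m + p + i" using assms(2) le_Suc_ex by blast
  have "(\<sigma> ^^ i) [c] \<noteq> []" using length_pow_ge[of "[c]" i] by auto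
  then obtain d w where d: "(\<sigma> ^^ i) [c] = d # w" by (meson neq_Nil_conv)
  have "sublist ((\<sigma> ^^ m) [a]) ((\<sigma> ^^ m) ((\<sigma> ^^ p) [d]))"
    by (intro pow_sublist sublist_pow_letter)
  also have "sublist \<dots> ((\<sigma> ^^ (m + p)) ((\<sigma> ^^ i) [c]))"
    unfolding pow_add by (intro pow_sublist) (auto simp: d sublist_def intro: exI[of _ "[]"])
  finally show ?thesis using assms(1) by (auto simp: j pow_add)
qed

definition maxlen :: "nat \<Rightarrow> nat" where
  "maxlen n = Max (range (\<lambda>a. length ((\<sigma> ^^ n) [a])))"

lemma length_le_maxlen: "length ((\<sigma> ^^ n) [a]) \<le> maxlen n"
  unfolding maxlen_def by (rule Max_ge) auto

lemma maxlen_attained: "\<exists>a. maxlen n = length ((\<sigma> ^^ n) [a])"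
proof -
  have "maxlen n \<in> range (\<lambda>a. length ((\<sigma> ^^ n) [a]))"
    unfolding maxlen_def by (rule Max_in) auto
  then show ?thesis by blast
qed

lemma maxlen_pos: "1 \<le> maxlen n"
  using length_le_maxlen[of n undefined] length_pow_ge[of "[undefined]" n] by simp

lemma length_pow_le: "length ((\<sigma> ^^ n) u) \<le> length u * maxlen n"
proof (induction u)
  case (Cons a u)
  have "(\<sigma> ^^ n) (a # u) = (\<sigma> ^^ n) [a] @ (\<sigma> ^^ n) u" using pow_append[of n "[a]" u] by simp
  then show ?case using Cons length_le_maxlen[of n a] by simp
qed (simp add: pow_Nil)

lemma maxlen_add: "maxlen (m + n) \<le> maxlen m * maxlen n"
proof -
  obtain a where "maxlen (m + n) = length ((\<sigma> ^^ m) ((\<sigma> ^^ n) [a]))"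
    using maxlen_attained[of "m + n"] by (auto simp: pow_add)
  also have "\<dots> \<le> length ((\<sigma> ^^ n) [a]) * maxlen m" by (rule length_pow_le)
  also have "\<dots> \<le> maxlen n * maxlen m" by (intro mult_right_mono length_le_maxlen) simp
  finally show ?thesis by (simp add: mult.commute)
qed

text \<open>All letters grow at comparable speed. For \<open>n \<ge> p\<close>, the
  \<open>p\<close>-th image of \<open>b\<close> already contains the letter growing longest in the
  remaining \<open>n - p\<close> steps, so only the factor \<open>maxlen p\<close> is lost. For
  \<open>n < p\<close>, \<open>maxlen n\<close> is itself at most \<open>maxlen p\<close>.\<close>

lemma maxlen_le: "maxlen n \<le> maxlen p * length ((\<sigma> ^^ n) [b])"
proof (cases "p \<le> n")
  case True
  then obtain k where n: "n = k + p" using le_Suc_ex add.commute by metis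
  obtain c where c: "maxlen k = length ((\<sigma> ^^ k) [c])" using maxlen_attained by blast
  have "maxlen n \<le> maxlen p * maxlen k" using maxlen_add[of k p] n by (simp add: mult.commute)
  also have "maxlen k \<le> length ((\<sigma> ^^ n) [b])"
    unfolding c n pow_add by (intro sublist_length_le pow_sublist sublist_pow_letter)
  finally show ?thesis by simp
next
  case False
  then obtain k where p: "p = k + n" using le_Suc_ex add.commute by (metis nat_le_linear)
  obtain a where "maxlen n = length ((\<sigma> ^^ n) [a])" using maxlen_attained by blast
  also have "\<dots> \<le> length ((\<sigma> ^^ p) [a])" unfolding p pow_add by (rule length_pow_ge)
  also have "\<dots> \<le> maxlen p * 1" using length_le_maxlen by simp
  also have "\<dots> \<le> maxlen p * length ((\<sigma> ^^ n) [b])"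
    using length_pow_ge[of "[b]" n] by (intro mult_left_mono) auto
  finally show ?thesis .
qed

text \<open>Let \<open>n\<close> be least such that all \<open>n\<close>-th images of letters are at
  least as long as \<open>u\<close>. Then \<open>u\<close> lies in the image of a word
  \<open>d\<close> of at most two letters, and \<open>d\<close> occurs in the \<open>q\<close>-th
  image of every letter. So \<open>u\<close> occurs in every image under exponent
  \<open>n + q\<close>. Minimality of \<open>n\<close> makes these images linear in the length of
  \<open>u\<close>, and \<open>v\<close> is long enough to contain one of them.\<close>

lemma linearly_recurrent:
  "\<exists>K. \<forall>u v. u \<noteq> [] \<longrightarrow> (\<exists>m a. sublist u ((\<sigma> ^^ m) [a])) \<longrightarrow>
     (\<exists>m a. sublist v ((\<sigma> ^^ m) [a])) \<longrightarrow> K * length u \<le> length v \<longrightarrow> sublist u v"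
proof -
  \<comment> \<open>There are finitely many such words, so one exponent \<open>q\<close> serves them
    all.\<close>
  define D where "D = {d. length d \<le> 2 \<and> (\<exists>m a. sublist d ((\<sigma> ^^ m) [a]))}"
  have "finite D"
    by (rule finite_subset[OF _ finite_lists_length_le[of "UNIV :: 'a set" 2]]) (auto simp: D_def)
  moreover have "\<forall>d\<in>D. \<forall>\<^sub>F j in sequentially. \<forall>c. sublist d ((\<sigma> ^^ j) [c])"
    unfolding D_def eventually_sequentially using sublist_pow_eventually by blast
  ultimately have "\<forall>\<^sub>F j in sequentially. \<forall>d\<in>D. \<forall>c. sublist d ((\<sigma> ^^ j) [c])"
    by (rule eventually_ball_finite)
  then obtain q where q: "\<And>d c. d \<in> D \<Longrightarrow> sublist d ((\<sigma> ^^ q) [c])"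
    by (auto simp: eventually_sequentially)
  \<comment> \<open>The first summand handles \<open>n = 0\<close>; the second handles
    \<open>n = Suc k\<close>, where minimality bounds \<open>maxlen k\<close>.\<close>
  define K where "K = maxlen q + maxlen p * maxlen (q + 1)"
  have "sublist u v" if u: "u \<noteq> []" "sublist u ((\<sigma> ^^ m) [a])"
    and v: "sublist v ((\<sigma> ^^ m') [a'])" "2 * K * length u \<le> length v" for u v m a m' a'
  proof -
    let ?Q = "\<lambda>n. \<forall>b. length u \<le> length ((\<sigma> ^^ n) [b])"
    \<comment> \<open>The factor \<open>maxlen p\<close> cancels against \<open>maxlen_le\<close>,
      so that even the shortest image is as long as \<open>u\<close>.\<close>
    obtain n1 a1 where "maxlen p * length u \<le> length ((\<sigma> ^^ n1) [a1])" using growing by blast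
    then have "maxlen p * length u \<le> maxlen p * length ((\<sigma> ^^ n1) [b])" for b
      using length_le_maxlen[of n1 a1] maxlen_le[of n1 b] by linarith
    then have "?Q n1" using maxlen_pos[of p] by simp
    define n where "n = (LEAST n. ?Q n)"
    have n: "?Q n" unfolding n_def using \<open>?Q n1\<close> by (rule LeastI)
    have len: "maxlen (n + q) \<le> K * length u"
    proof (cases n)
      case 0
      have "maxlen q * 1 \<le> K * length u"
        using u(1) by (intro mult_mono) (auto simp: K_def Suc_leI)
      then show ?thesis using 0 by simp
    next
      case (Suc k)
      then have "\<not> ?Q k" unfolding n_def by (intro not_less_Least) simp
      then obtain b where "length ((\<sigma> ^^ k) [b]) \<le> length u" by (meson nat_le_linear)
      then have "maxlen p * length ((\<sigma> ^^ k) [b]) \<le> maxlen p * length u" by simp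
      then have "maxlen k \<le> maxlen p * length u" using maxlen_le[of k b] by linarith
      then have "maxlen k * maxlen (q + 1) \<le> maxlen p * length u * maxlen (q + 1)"
        by (rule mult_right_mono) simp
      also have "\<dots> \<le> K * length u" by (simp add: K_def algebra_simps)
      finally show ?thesis using maxlen_add[of k "q + 1"] Suc by simp
    qed
    have "sublist u ((\<sigma> ^^ (n + (m + p))) [a])"
      using u(2) by (rule sublist_pow_eventually) simp
    then have "sublist u (concat (map (\<lambda>c. (\<sigma> ^^ n) [c]) ((\<sigma> ^^ (m + p)) [a])))"
      by (simp only: pow_add pow_concat[of n "(\<sigma> ^^ m) ((\<sigma> ^^ p) [a])"])
    from sublist_concat_map_short[OF this u(1)] n
    obtain d where d: "length d \<le> 2" "sublist d ((\<sigma> ^^ (m + p)) [a])"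
      "sublist u (concat (map (\<lambda>c. (\<sigma> ^^ n) [c]) d))"
      by blast
    have dD: "d \<in> D" using d(1,2) unfolding D_def by blast
    have ud: "sublist u ((\<sigma> ^^ n) d)" using d(3) by (simp only: pow_concat[symmetric])
    have uc: "sublist u ((\<sigma> ^^ (n + q)) [c])" for c
      using ud pow_sublist[OF q[OF dD, of c], of n] by (metis pow_add sublist_order.order_trans)
    have "sublist v ((\<sigma> ^^ (n + q + (m' + p))) [a'])"
      using v(1) by (rule sublist_pow_eventually) simp
    then have "sublist v (concat (map (\<lambda>c. (\<sigma> ^^ (n + q)) [c]) ((\<sigma> ^^ (m' + p)) [a'])))"
      unfolding pow_add[of "n + q" "m' + p"] by (simp only: pow_concat[of "n + q" "(\<sigma> ^^ (m' + p)) [a']"])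
    then have "\<exists>c. sublist ((\<sigma> ^^ (n + q)) [c]) v"
      by (rule sublist_concat_map_long[where M = "maxlen (n + q)"])
        (use len v(2) length_le_maxlen maxlen_pos in auto)
    then show ?thesis using uc sublist_order.order_trans by blast
  qed
  then show ?thesis by (intro exI[of _ "2 * K"]) blast
qed

end

section \<open>Words and connected extension graphs\<close>

lemma length_factor [simp]: "length (factor x i j) = nat (j - i)"
  by (simp add: factor_def)

lemma nth_factor [simp]: "int k < j - i \<Longrightarrow> factor x i j ! k = x (i + int k)"
  by (simp add: factor_def)

lemma factor_eq_iff:
  "factor x i (i + int n) = factor y j (j + int n) \<longleftrightarrow> (\<forall>k<n. x (i + int k) = y (j + int k))"
  by (auto simp: list_eq_iff_nth_eq)

lemma factor_append: "i \<le> j \<Longrightarrow> j \<le> k \<Longrightarrow> factor x i k = factor x i j @ factor x j k"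
proof -
  assume "i \<le> j" "j \<le> k"
  then have "[i..k - 1] = [i..j - 1] @ [j..k - 1]"
    using upto_split1[of i "j" "k - 1"] by (cases "j = k") auto
  then show ?thesis by (simp add: factor_def)
qed

lemma factor_translate: "factor (\<lambda>n. x (n + s)) i j = factor x (i + s) (j + s)"
  by (auto simp: list_eq_iff_nth_eq algebra_simps)

lemma factor_shift_map: "factor (shift_map x) i j = factor x (i + 1) (j + 1)"
  unfolding shift_map_def by (rule factor_translate)

lemma factor_Cons: "i < j \<Longrightarrow> factor x i j = x i # factor x (i + 1) j"
  using factor_append[of i "i + 1" j x] by (simp add: factor_def)

lemma factor_snoc: "i < j \<Longrightarrow> factor x i j = factor x i (j - 1) @ [x (j - 1)]"
  using factor_append[of i "j - 1" j x] by (simp add: factor_def)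

lemma factor_empty [simp]: "factor x i i = []"
  by (simp add: factor_def)

lemma factor_eq_appendD:
  assumes "factor x i (i + int n) = u1 @ u2 @ u3"
  shows "factor x i (i + int (length u1)) = u1"
    and "factor x (i + int (length u1)) (i + int (length u1) + int (length u2)) = u2"
proof -
  define l where "l = i + int (length u1)"
  define l' where "l' = l + int (length u2)"
  have "n = length (u1 @ u2 @ u3)" using arg_cong[OF assms, of length] by simp
  then have "factor x i (i + int n) = factor x i l @ factor x l l' @ factor x l' (i + int n)"
    using factor_append[of i l "i + int n" x] factor_append[of l l' "i + int n" x]
    by (simp add: l_def l'_def)
  then have "factor x i l = u1 \<and> factor x l l' = u2"
    unfolding assms by (simp add: l_def l'_def append_eq_append_conv)
  then show "factor x i (i + int (length u1)) = u1"
    "factor x (i + int (length u1)) (i + int (length u1) + int (length u2)) = u2"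
    by (auto simp: l_def l'_def)
qed

lemma shift_space_translate:
  assumes "shift_space X" "x \<in> X"
  shows "(\<lambda>n. x (n + s)) \<in> X"
proof -
  have img: "shift_map ` X = X" using assms(1) by (simp add: shift_space_def)
  show ?thesis
  proof (induction s rule: int_induct[where k = 0])
    case base
    then show ?case using assms(2) by simp
  next
    case (step1 s)
    then have "shift_map (\<lambda>n. x (n + s)) \<in> X" using img by blast
    then show ?case by (simp add: shift_map_def algebra_simps)
  next
    \<comment> \<open>Because \<open>X\<close> is its own image under \<open>shift_map\<close>, a
      preimage \<open>y\<close> exists in \<open>X\<close>, and it can only be the translate by
      \<open>s - 1\<close>.\<close>
    case (step2 s)
    then obtain y where y: "y \<in> X" "(\<lambda>n. x (n + s)) = shift_map y" using img by blast
    have "y = (\<lambda>n. x (n + (s - 1)))"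
    proof
      fix n
      show "y n = x (n + (s - 1))"
        using fun_cong[OF y(2), of "n - 1"] by (simp add: shift_map_def algebra_simps)
    qed
    then show ?case using y(1) by simp
  qed
qed

lemma shift_map_in: "shift_space X \<Longrightarrow> x \<in> X \<Longrightarrow> shift_map x \<in> X"
  using shift_space_translate[of X x 1] by (simp add: shift_map_def)

lemma lang_iff_prefix:
  assumes "shift_space X"
  shows "w \<in> lang X \<longleftrightarrow> (\<exists>x\<in>X. factor x 0 (int (length w)) = w)"
proof
  assume "w \<in> lang X"
  then obtain x i j where x: "x \<in> X" "i \<le> j" "w = factor x i j" by (auto simp: lang_def)
  then have "factor (\<lambda>n. x (n + i)) 0 (int (length w)) = w"
    by (simp add: factor_translate)
  then show "\<exists>x\<in>X. factor x 0 (int (length w)) = w"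
    using shift_space_translate[OF assms x(1)] by blast
next
  assume "\<exists>x\<in>X. factor x 0 (int (length w)) = w"
  then show "w \<in> lang X" unfolding lang_def by (metis (mono_tags, lifting) mem_Collect_eq of_nat_0_le_iff)
qed

text \<open>If \<open>c\<close> is determined by \<open>k + 1\<close> letters, then the value of \<open>c\<close> behind the word \<open>v\<close> of
  length \<open>k\<close> is a function on the vertices of the extension graph of \<open>v\<close> which agrees at the
  ends of each edge; connectedness makes it a function of \<open>v\<close> alone.\<close>

lemma dendric_cocycle_constant:
  fixes c :: "(int \<Rightarrow> 'a::finite) \<Rightarrow> 'b"
  assumes X: "dendric_shift X"
    and local: "\<And>x y. x \<in> X \<Longrightarrow> y \<in> X \<Longrightarrow> factor x 0 (int m) = factor y 0 (int m) \<Longrightarrow> c x = c y"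
    and step: "\<And>x y. x \<in> X \<Longrightarrow> y \<in> X \<Longrightarrow> x 0 = y 0 \<Longrightarrow> c x = c y \<Longrightarrow>
      c (shift_map x) = c (shift_map y)"
    and xy: "x \<in> X" "y \<in> X"
  shows "c x = c y"
proof -
  have sh: "shift_space X" using X by (simp add: dendric_shift_def)
  let ?L = "\<lambda>k. \<forall>x\<in>X. \<forall>y\<in>X. factor x 0 (int k) = factor y 0 (int k) \<longrightarrow> c x = c y"
  have "?L k" if L: "?L (Suc k)" for k
  proof (intro ballI impI)
    fix x y assume x: "x \<in> X" and y: "y \<in> X" and eq: "factor x 0 (int k) = factor y 0 (int k)"
    define v where "v = factor x 0 (int k)"
    have len: "length v = k" by (simp add: v_def)
    \<comment> \<open>On both sides \<open>c\<close> is read where \<open>v\<close> begins; behind a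
      left letter \<open>a\<close> this is one step later, hence the
      \<open>shift_map\<close>.\<close>
    define V where "V t = (case t of
        Inl a \<Rightarrow> {c (shift_map z) | z. z \<in> X \<and> factor z 0 (int (Suc k)) = a # v}
      | Inr b \<Rightarrow> {c z | z. z \<in> X \<and> factor z 0 (int (Suc k)) = v @ [b]})" for t
    \<comment> \<open>At a left vertex, \<open>L\<close> first gives equality one step earlier, in
      front of \<open>a\<close>, and \<open>step\<close> carries it across \<open>a\<close>.\<close>
    have uniq: "d = e" if de: "d \<in> V t" "e \<in> V t" for d e t
    proof (cases t)
      case (Inl a)
      then obtain z z' where z: "z \<in> X" "factor z 0 (int (Suc k)) = a # v" "d = c (shift_map z)"
        "z' \<in> X" "factor z' 0 (int (Suc k)) = a # v" "e = c (shift_map z')"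
        using de by (auto simp: V_def)
      have "z 0 = z' 0" using z(2,5) factor_Cons[of 0 "int (Suc k)" z] factor_Cons[of 0 "int (Suc k)" z'] by simp
      then show ?thesis using z L step by metis
    next
      case (Inr b)
      then obtain z z' where "z \<in> X" "factor z 0 (int (Suc k)) = v @ [b]" "d = c z"
        "z' \<in> X" "factor z' 0 (int (Suc k)) = v @ [b]" "e = c z'"
        using de by (auto simp: V_def)
      then show ?thesis using L by metis
    qed
    \<comment> \<open>A point beginning with \<open>a v b\<close> begins with \<open>v b\<close>
      after one shift, so its value there belongs to both ends of the edge.\<close>
    have edge: "V t \<inter> V s \<noteq> {}" if ts: "{t, s} \<in> snd (extension_graph X v)" for t s
    proof -
      obtain a b where ab: "{t, s} = {Inl a, Inr b}" "[a] @ v @ [b] \<in> lang X"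
        using ts by (auto simp: extension_graph_def)
      then obtain z where z: "z \<in> X" "factor z 0 (int (k + 2)) = [a] @ v @ [b]"
        using lang_iff_prefix[OF sh] len by force
      have "factor z 0 (int (Suc k)) = a # v"
        using z(2) factor_snoc[of 0 "int (k + 2)" z] by (simp add: algebra_simps)
      moreover have "factor (shift_map z) 0 (int (Suc k)) = v @ [b]"
        using z(2) factor_Cons[of 0 "int (k + 2)" z] by (simp add: factor_shift_map algebra_simps)
      ultimately have "c (shift_map z) \<in> V (Inl a) \<inter> V (Inr b)"
        using z(1) shift_map_in[OF sh z(1)] by (auto simp: V_def)
      then show ?thesis using ab(1) by (auto simp: doubleton_eq_iff)
    qed
    have walk_eq: "d = e" if "walk (extension_graph X v) p" "d \<in> V (hd p)" "e \<in> V (last p)" for p d e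
      using that
    proof (induction p arbitrary: d)
      case Nil
      then show ?case by (simp add: walk_def)
    next
      case (Cons t p)
      show ?case
      proof (cases p)
        case Nil
        then show ?thesis using Cons.prems uniq by simp
      next
        case (Cons s p')
        with Cons.prems(1) have w: "walk (extension_graph X v) p" "{t, s} \<in> snd (extension_graph X v)"
          by (auto simp: walk_def)
        obtain e' where "e' \<in> V t" "e' \<in> V s" using edge[OF w(2)] by blast
        then show ?thesis
          using uniq[of d t e'] Cons.IH[OF w(1), of e'] Cons.prems Cons by simp
      qed
    qed
    \<comment> \<open>The letter after \<open>v\<close> places every point beginning with
      \<open>v\<close> at a right vertex, so two such points are compared along a walk between right
      vertices.\<close>
    have ext: "c z \<in> V (Inr (z (int k)))" "Inr (z (int k)) \<in> fst (extension_graph X v)"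
      if z: "z \<in> X" "factor z 0 (int k) = v" for z
    proof -
      have e: "factor z 0 (int (Suc k)) = v @ [z (int k)]"
        using z(2) factor_snoc[of 0 "int (Suc k)" z] by simp
      then show "c z \<in> V (Inr (z (int k)))" using z(1) by (auto simp: V_def)
      have "v @ [z (int k)] \<in> lang X"
        unfolding lang_iff_prefix[OF sh] using z(1) e len by (intro bexI[of _ z]) auto
      then show "Inr (z (int k)) \<in> fst (extension_graph X v)"
        by (simp add: extension_graph_def)
    qed
    have "v \<in> lang X" unfolding lang_iff_prefix[OF sh] using x len by (intro bexI[of _ x]) (simp_all add: v_def)
    then have "connected_graph (extension_graph X v)"
      using X by (simp add: dendric_shift_def tree_def)
    then obtain p where "walk (extension_graph X v) p" "hd p = Inr (x (int k))" "last p = Inr (y (int k))"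
      unfolding connected_graph_def using ext(2)[OF x v_def[symmetric]] ext(2)[OF y] eq v_def by metis
    then show "c x = c y"
      using walk_eq ext(1)[OF x] ext(1)[OF y] eq v_def by metis
  qed
  then have "?L 0" if "?L k" for k
    using that by (induction k) blast+
  moreover have "?L m" using local by blast
  ultimately have "?L 0" by blast
  then show ?thesis using xy unfolding of_nat_0 factor_empty by blast
qed

section \<open>Linear recurrence of the skew product\<close>

locale dendric_skew_product = group G
  for G :: "('g, 'm) monoid_scheme" (structure) +
  fixes X :: "(int \<Rightarrow> 'a::finite) set" and \<phi> :: "'a list \<Rightarrow> 'g" and K :: nat
  assumes dendric: "dendric_shift X"
    and fin: "finite (carrier G)"
    and phi_append: "\<phi> (u @ v) = \<phi> u \<otimes> \<phi> v"
    and phi_closed [simp, intro]: "\<phi> u \<in> carrier G"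
    and phi_Nil: "\<phi> [] = \<one>"
    and phi_surj: "g \<in> carrier G \<Longrightarrow> \<exists>u. \<phi> u = g"
    and lin_rec: "u \<in> lang X \<Longrightarrow> v \<in> lang X \<Longrightarrow> u \<noteq> [] \<Longrightarrow> K * length u \<le> length v \<Longrightarrow> sublist u v"
begin

lemma shiftX: "shift_space X"
  using dendric by (simp add: dendric_shift_def)

lemma factor_in_lang: "x \<in> X \<Longrightarrow> i \<le> j \<Longrightarrow> factor x i j \<in> lang X"
  by (auto simp: lang_def)

lemma occurrence:
  assumes "x \<in> X" "w \<in> lang X" "w \<noteq> []"
  shows "\<exists>i. i + length w \<le> K * length w \<and> factor x (int i) (int i + int (length w)) = w"
proof -
  have "sublist w (factor x 0 (int (K * length w)))"
    using assms by (intro lin_rec factor_in_lang) (simp_all del: of_nat_mult)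
  then obtain p s where ps: "factor x 0 (0 + int (K * length w)) = p @ w @ s"
    by (auto simp: sublist_def)
  have "K * length w = length p + length w + length s"
    using arg_cong[OF ps, of length] by (simp del: of_nat_mult)
  then show ?thesis
    using factor_eq_appendD(2)[OF ps] by (intro exI[of _ "length p"]) auto
qed

abbreviation translate :: "'g \<Rightarrow> 'g set \<Rightarrow> 'g set" where
  "translate a P \<equiv> (\<lambda>g. a \<otimes> g) ` P"

lemma translate_mult:
  "a \<in> carrier G \<Longrightarrow> b \<in> carrier G \<Longrightarrow> P \<subseteq> carrier G \<Longrightarrow> translate (a \<otimes> b) P = translate a (translate b P)"
  by (auto simp: image_image m_assoc subset_iff intro!: image_cong)

lemma translate_inj:
  assumes "a \<in> carrier G" "P \<subseteq> carrier G" "Q \<subseteq> carrier G" "translate a P = translate a Q"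
  shows "P = Q"
  using inj_on_image_eq_iff[OF inj_on_cmult[OF assms(1)] assms(2,3)] assms(4) by simp

lemma card_translate: "a \<in> carrier G \<Longrightarrow> P \<subseteq> carrier G \<Longrightarrow> card (translate a P) = card P"
  using inj_on_subset[OF inj_on_cmult, of a P] by (rule card_image)

text \<open>The return words to \<open>w\<close> stabilise no proper subset of \<open>G\<close>, i.e. their images generate \<open>G\<close>:
  the translate of \<open>P\<close> by the path from \<open>x\<close> to the next occurrence of \<open>w\<close> does not depend on
  that occurrence, and is hence a locally constant function to which the
  connectedness argument applies.\<close>

lemma stable_under_returns:
  assumes w: "w \<in> lang X" "w \<noteq> []" and P: "P \<subseteq> carrier G" "P \<noteq> {}"
    and ret: "\<And>r. r @ w \<in> lang X \<Longrightarrow> prefix w (r @ w) \<Longrightarrow> length r \<le> K * length w \<Longrightarrow>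
      translate (\<phi> r) P = P"
  shows "P = carrier G"
proof -
  define l where "l = length w"
  have l1: "l \<ge> 1" using w(2) by (simp add: l_def Suc_leI)
  \<comment> \<open>The first occurrence of \<open>w\<close> at a nonnegative position. It ends
    within the first \<open>K * l\<close> letters, which therefore determine it.\<close>
  define i where "i x = (LEAST i. factor x (int i) (int i + int l) = w)" for x
  have i: "factor x (int (i x)) (int (i x) + int l) = w" "i x + l \<le> K * l" if x: "x \<in> X" for x
  proof -
    obtain j where j: "j + l \<le> K * l" "factor x (int j) (int j + int l) = w"
      using occurrence[OF x w] by (auto simp: l_def)
    show "factor x (int (i x)) (int (i x) + int l) = w"
      unfolding i_def by (rule LeastI) (rule j(2))
    have "i x \<le> j" unfolding i_def by (rule Least_le) (rule j(2))
    then show "i x + l \<le> K * l" using j(1) by simp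
  qed
  have i_le: "i x \<le> j" if "factor x (int j) (int j + int l) = w" for x j
    unfolding i_def using that by (rule Least_le)
  define c where "c x = translate (\<phi> (factor x 0 (int (i x)))) P" for x
  have c_sub: "c x \<subseteq> carrier G" for x
    using P(1) by (auto simp: c_def)
  have local: "c x = c y"
    if xy: "x \<in> X" "y \<in> X" "factor x 0 (int (K * l)) = factor y 0 (int (K * l))" for x y
  proof -
    have eq: "x (int k) = y (int k)" if "k < K * l" for k
      using xy(3) factor_eq_iff[of x 0 "K * l" y 0] that by simp
    have "i y \<le> i x" if "x \<in> X" "\<And>k. k < K * l \<Longrightarrow> x (int k) = y (int k)" for x y
    proof -
      have "factor y (int (i x)) (int (i x) + int l) = factor x (int (i x)) (int (i x) + int l)"
        unfolding factor_eq_iff using that(2)[of "i x + _"] i(2)[OF that(1)] by auto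
      then show ?thesis using i(1)[OF that(1)] by (intro i_le) simp
    qed
    from this[of x y] this[of y x] have "i x = i y" using xy(1,2) eq by (simp add: le_antisym)
    moreover have "factor x 0 (0 + int (i x)) = factor y 0 (0 + int (i x))"
      unfolding factor_eq_iff using eq i(2)[OF xy(1)] by auto
    ultimately show ?thesis by (simp add: c_def)
  qed
  have c_shift: "c x = translate (\<phi> [x 0]) (c (shift_map x))" if x: "x \<in> X" for x
  proof -
    define j where "j = i (shift_map x)"
    have sx: "shift_map x \<in> X" using shift_map_in[OF shiftX x] .
    have j: "factor x (int j + 1) (int j + 1 + int l) = w" "j + l \<le> K * l"
      using i[OF sx] by (auto simp: j_def factor_shift_map algebra_simps)
    have split: "factor x 0 (int j + 1) = [x 0] @ factor (shift_map x) 0 (int j)"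
      by (simp add: factor_Cons factor_shift_map)
    \<comment> \<open>If \<open>w\<close> does not begin at \<open>0\<close>, both sides refer to
      the same occurrence. If it does, the word up to the next occurrence is a return word, and
      \<open>ret\<close> absorbs it.\<close>
    have "translate (\<phi> (factor x 0 (int (i x)))) P = translate (\<phi> (factor x 0 (int j + 1))) P"
    proof (cases "i x")
      case 0
      have rw: "factor x 0 (int j + 1) @ w = factor x 0 (int j + 1 + int l)"
        using factor_append[of 0 "int j + 1" "int j + 1 + int l" x] j(1) by simp
      have "factor x 0 (int j + 1 + int l) = w @ factor x (int l) (int j + 1 + int l)"
        using factor_append[of 0 "int l" "int j + 1 + int l" x] i(1)[OF x] 0 by simp
      then have "prefix w (factor x 0 (int j + 1) @ w)" unfolding rw by simp
      moreover have "factor x 0 (int j + 1) @ w \<in> lang X"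
        unfolding rw using x by (intro factor_in_lang) auto
      \<comment> \<open>The length is \<open>j + 1\<close>, and \<open>j + l \<le> K * l\<close>
        leaves room for the extra letter since \<open>l \<ge> 1\<close>.\<close>
      moreover have "length (factor x 0 (int j + 1)) \<le> K * length w"
        using j(2) l1 by (simp add: l_def nat_add_distrib)
      ultimately have "translate (\<phi> (factor x 0 (int j + 1))) P = P" using ret by blast
      moreover have "translate \<one> P = P" using P(1) by (auto simp: subset_iff image_iff)
      ultimately show ?thesis using 0 by (simp add: phi_Nil)
    next
      case (Suc k)
      have "factor (shift_map x) (int k) (int k + int l) = w"
        using i(1)[OF x] Suc by (simp add: factor_shift_map algebra_simps)
      then have "j \<le> k" unfolding j_def by (rule i_le)
      moreover have "i x \<le> Suc j" using j(1) by (intro i_le) (simp add: algebra_simps)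
      ultimately have "i x = Suc j" using Suc by simp
      then show ?thesis by (simp add: algebra_simps)
    qed
    then show ?thesis
      unfolding c_def split phi_append j_def[symmetric] using P(1) by (simp add: translate_mult)
  qed
  have const: "c x = c y" if xy: "x \<in> X" "y \<in> X" for x y
  proof (rule dendric_cocycle_constant[OF dendric, where c = c and m = "K * l", OF local _ xy])
    fix x y assume xy: "x \<in> X" "y \<in> X" "x 0 = y 0" "c x = c y"
    have "translate (\<phi> [x 0]) (c (shift_map x)) = translate (\<phi> [x 0]) (c (shift_map y))"
      using c_shift[OF xy(1)] c_shift[OF xy(2)] xy(3,4) by (simp only:)
    then show "c (shift_map x) = c (shift_map y)"
      by (rule translate_inj[OF phi_closed c_sub c_sub])
  qed
  have "X \<noteq> {}" and letters: "\<forall>a. \<exists>x\<in>X. a \<in> range x"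
    using shiftX by (simp_all add: shift_space_def)
  then obtain x where x: "x \<in> X" by blast
  have inv_letter: "translate (\<phi> [a]) (c x) = c x" for a
  proof -
    obtain y k where y: "y \<in> X" "y k = a" using letters by (metis rangeE)
    define z where "z = (\<lambda>n. y (n + k))"
    have z: "z \<in> X" "z 0 = a" unfolding z_def using shift_space_translate[OF shiftX y(1)] y(2) by auto
    show ?thesis
      using c_shift[OF z(1)] const[OF x z(1)] const[OF x shift_map_in[OF shiftX z(1)]] z(2) by metis
  qed
  have inv_word: "translate (\<phi> u) (c x) = c x" for u
  proof (induction u)
    case Nil
    then show ?case using c_sub[of x] by (auto simp: phi_Nil subset_iff image_iff)
  next
    case (Cons a u)
    then show ?case
      using phi_append[of "[a]" u] inv_letter[of a] c_sub[of x] by (simp add: translate_mult)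
  qed
  \<comment> \<open>The nonempty set \<open>c x\<close> is invariant under left multiplication by
    all images of \<open>\<phi>\<close>, that is, by all of \<open>G\<close>.\<close>
  have "carrier G \<subseteq> c x"
  proof
    fix g assume g: "g \<in> carrier G"
    obtain h where h: "h \<in> c x" using P(2) by (auto simp: c_def)
    then have hG: "h \<in> carrier G" using c_sub by blast
    obtain u where "\<phi> u = g \<otimes> inv h" using phi_surj g hG by blast
    then have "g = \<phi> u \<otimes> h" using g hG by (simp add: m_assoc)
    then show "g \<in> c x" using inv_word[of u] h by blast
  qed
  \<comment> \<open>As a translate of \<open>P\<close>, the set \<open>c x\<close> has the
    cardinality of \<open>P\<close>.\<close>
  then have "card (carrier G) \<le> card P"
    using card_mono[of "c x" "carrier G"] c_sub[of x] fin card_translate[OF _ P(1)]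
    by (metis c_def finite_subset phi_closed)
  then show ?thesis using P(1) fin by (simp add: card_seteq)
qed

definition visits :: "'a list \<Rightarrow> 'a list \<Rightarrow> 'g set" where
  "visits v W = {\<phi> p | p s. W = p @ v @ s}"

lemma visits_subset: "visits v W \<subseteq> carrier G"
  by (auto simp: visits_def)

lemma visits_append: "translate (\<phi> r) (visits v W) \<subseteq> visits v (r @ W)"
proof
  fix g assume "g \<in> translate (\<phi> r) (visits v W)"
  then obtain p s where "g = \<phi> (r @ p)" "W = p @ v @ s" by (auto simp: visits_def phi_append)
  moreover from this have "r @ W = (r @ p) @ v @ s" by simp
  ultimately show "g \<in> visits v (r @ W)" unfolding visits_def by blast
qed

lemma visits_prefix: "prefix W W' \<Longrightarrow> visits v W \<subseteq> visits v W'"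
  by (auto simp: visits_def prefix_def)

text \<open>Each round prepends a word \<open>r\<close> that does not stabilise the current set.
  This adds at least one group element and multiplies the length by at most
  \<open>K + 1\<close>.\<close>

lemma visits_all:
  assumes v: "v \<in> lang X" "v \<noteq> []"
  shows "\<exists>W\<in>lang X. length W \<le> (K + 1) ^ card (carrier G) * length v \<and> W \<noteq> [] \<and> visits v W = carrier G"
proof -
  have "\<exists>W\<in>lang X. length W \<le> (K + 1) ^ k * length v \<and> W \<noteq> [] \<and> visits v W \<noteq> {} \<and>
      (visits v W = carrier G \<or> k < card (visits v W))" for k
  proof (induction k)
    case 0
    have "\<phi> [] \<in> visits v v" unfolding visits_def by fastforce
    then have "visits v v \<noteq> {}" by blast
    moreover have "finite (visits v v)" using visits_subset fin finite_subset by blast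
    ultimately show ?case using v by (intro bexI[of _ v]) (auto simp: card_gt_0_iff)
  next
    case (Suc k)
    then obtain W where W: "W \<in> lang X" "length W \<le> (K + 1) ^ k * length v" "W \<noteq> []"
      "visits v W \<noteq> {}" "visits v W = carrier G \<or> k < card (visits v W)" by blast
    show ?case
    proof (cases "visits v W = carrier G")
      case True
      have "(K + 1) ^ k * length v \<le> (K + 1) ^ Suc k * length v"
        by (intro mult_right_mono power_increasing) auto
      then have "length W \<le> (K + 1) ^ Suc k * length v" using W(2) by (rule order_trans[rotated])
      then show ?thesis using W True by blast
    next
      case False
      then obtain r where r: "r @ W \<in> lang X" "prefix W (r @ W)" "length r \<le> K * length W"
        "translate (\<phi> r) (visits v W) \<noteq> visits v W"
        using stable_under_returns[OF W(1,3) visits_subset W(4)] by blast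
      have sub: "visits v W \<subseteq> visits v (r @ W)" using r(2) by (rule visits_prefix)
      have fin': "finite (visits v (r @ W))" using visits_subset fin finite_subset by blast
      \<comment> \<open>Without growth, the translate by \<open>\<phi> r\<close> would lie inside a
        set of the same finite cardinality and so equal it, against the choice of
        \<open>r\<close>.\<close>
      have "visits v W \<noteq> visits v (r @ W)"
      proof
        assume "visits v W = visits v (r @ W)"
        then have "translate (\<phi> r) (visits v W) \<subseteq> visits v W" using visits_append by metis
        then have "translate (\<phi> r) (visits v W) = visits v W"
          using card_translate[OF phi_closed visits_subset] fin' sub finite_subset
          by (metis card_subset_eq)
        then show False using r(4) by simp
      qed
      then have "card (visits v W) < card (visits v (r @ W))"
        using sub fin' by (intro psubset_card_mono) auto
      moreover have "length (r @ W) \<le> (K + 1) ^ Suc k * length v"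
      proof -
        have "length (r @ W) \<le> (K + 1) * length W" using r(3) by simp
        also have "\<dots> \<le> (K + 1) * ((K + 1) ^ k * length v)" by (intro mult_left_mono W(2)) simp
        finally show ?thesis by (simp only: power_Suc mult.assoc)
      qed
      ultimately show ?thesis
        using r(1) W(3,4,5) False sub by (intro bexI[of _ "r @ W"]) auto
    qed
  qed
  \<comment> \<open>After this many rounds the strict alternative would exceed the cardinality of
    \<open>G\<close>.\<close>
  from this[of "card (carrier G)"] show ?thesis
    using card_mono[OF fin visits_subset[of v]] leD by blast
qed

text \<open>Whatever group element \<open>g'\<close> is reached when \<open>W\<close> begins, some
  occurrence of \<open>v\<close> inside \<open>W\<close> supplies the missing factor
  \<open>inv g' \<otimes> h\<close>.\<close>

lemma skew_occurrence:
  assumes g: "g \<in> carrier G" "h \<in> carrier G" and x: "x \<in> X" and v: "v \<in> lang X" "v \<noteq> []"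
  shows "\<exists>i. i + length v \<le> K * (K + 1) ^ card (carrier G) * length v \<and>
    factor x (int i) (int i + int (length v)) = v \<and> g \<otimes> \<phi> (factor x 0 (int i)) = h"
proof -
  obtain W where W: "W \<in> lang X" "length W \<le> (K + 1) ^ card (carrier G) * length v" "W \<noteq> []"
    "visits v W = carrier G" using visits_all[OF v] by blast
  obtain j where j: "j + length W \<le> K * length W" "factor x (int j) (int j + int (length W)) = W"
    using occurrence[OF x W(1,3)] by blast
  define g' where "g' = g \<otimes> \<phi> (factor x 0 (int j))"
  have g': "g' \<in> carrier G" using g by (simp add: g'_def)
  then have "inv g' \<otimes> h \<in> visits v W" using W(4) g by simp
  then obtain p s where p: "\<phi> p = inv g' \<otimes> h" "W = p @ v @ s" by (auto simp: visits_def)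
  have f: "factor x (int j) (int j + int (length p)) = p"
    "factor x (int j + int (length p)) (int j + int (length p) + int (length v)) = v"
    using factor_eq_appendD[of x "int j" "length W" p v s] j(2) p(2) by auto
  show ?thesis
  proof (intro exI[of _ "j + length p"] conjI)
    have "j + length p + length v \<le> K * length W" using j(1) p(2) by simp
    also have "\<dots> \<le> K * ((K + 1) ^ card (carrier G) * length v)" by (intro mult_left_mono W(2)) simp
    finally show "j + length p + length v \<le> K * (K + 1) ^ card (carrier G) * length v"
      by (simp add: mult.assoc)
    show "factor x (int (j + length p)) (int (j + length p) + int (length v)) = v" using f(2) by simp
    have "factor x 0 (int (j + length p)) = factor x 0 (int j) @ p"
      using factor_append[of 0 "int j" "int (j + length p)" x] f(1) by simp
    then have "g \<otimes> \<phi> (factor x 0 (int (j + length p))) = g' \<otimes> \<phi> p"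
      using g by (simp add: phi_append g'_def m_assoc)
    then show "g \<otimes> \<phi> (factor x 0 (int (j + length p))) = h"
      using g' g by (simp add: p(1) m_assoc[symmetric])
  qed
qed

end

section \<open>Sets depending on finitely many coordinates\<close>

definition agree :: "nat \<Rightarrow> (int \<Rightarrow> 'a) \<Rightarrow> (int \<Rightarrow> 'a) \<Rightarrow> bool" where
  "agree k x y \<longleftrightarrow> (\<forall>t. - int k \<le> t \<longrightarrow> t < int k \<longrightarrow> x t = y t)"

lemma agree_mono: "agree k x y \<Longrightarrow> l \<le> k \<Longrightarrow> agree l x y"
  by (auto simp: agree_def)

lemma agree_sym: "agree k x y \<Longrightarrow> agree k y x"
  by (simp add: agree_def)

lemma agree_trans: "agree k x y \<Longrightarrow> agree k y z \<Longrightarrow> agree k x z"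
  by (simp add: agree_def)

lemma openin_agree: "openin full_shift_topology {y. agree k x y}"
proof -
  have "{y. agree k x y} = (\<Pi>\<^sub>E t\<in>UNIV. if - int k \<le> t \<and> t < int k then {x t} else UNIV)"
    by (auto simp: agree_def PiE_UNIV_domain Pi_iff split: if_splits)
  moreover have "finite {t. (if - int k \<le> t \<and> t < int k then {x t} else UNIV) \<noteq> UNIV}"
    by (rule finite_subset[of _ "{- int k..<int k}"]) auto
  ultimately show ?thesis
    unfolding full_shift_topology_def by (simp add: openin_PiE_gen)
qed

lemma openin_full_shift_agree:
  assumes "openin full_shift_topology U" "x \<in> U"
  shows "\<exists>k. \<forall>y. agree k x y \<longrightarrow> y \<in> U"
proof -
  obtain B where B: "finite {t. B t \<noteq> UNIV}" "x \<in> Pi\<^sub>E UNIV B" "Pi\<^sub>E UNIV B \<subseteq> U"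
    using assms unfolding full_shift_topology_def openin_product_topology_alt by auto
  \<comment> \<open>The inserted \<open>0\<close> covers the case of no restricted coordinate; the
    \<open>+ 1\<close> is due to the window being open on the right.\<close>
  define k where "k = nat (Max (insert 0 (abs ` {t. B t \<noteq> UNIV}))) + 1"
  have "\<bar>t\<bar> < int k" if "B t \<noteq> UNIV" for t
  proof -
    have "\<bar>t\<bar> \<le> Max (insert 0 (abs ` {t. B t \<noteq> UNIV}))" using B(1) that by (intro Max_ge) auto
    then show ?thesis unfolding k_def by linarith
  qed
  then have "y \<in> Pi\<^sub>E UNIV B" if "agree k x y" for y
  proof -
    have "y t \<in> B t" for t
    proof (cases "B t = UNIV")
      case False
      then have "x t = y t" using that \<open>\<And>t. B t \<noteq> UNIV \<Longrightarrow> \<bar>t\<bar> < int k\<close>[of t]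
        by (auto simp: agree_def)
      then show ?thesis using B(2) by (metis PiE_mem UNIV_I)
    qed simp
    then show ?thesis by (simp add: PiE_UNIV_domain)
  qed
  then show ?thesis using B(3) by blast
qed

text \<open>One \<open>k\<close> has to serve all points of \<open>C\<close>; this makes
  \<open>C\<close> both open and closed in the skew product.\<close>

definition window_sets :: "'g set \<Rightarrow> (int \<Rightarrow> 'a) set \<Rightarrow> ('g \<times> (int \<Rightarrow> 'a)) set set" where
  "window_sets H X = {C. C \<subseteq> H \<times> X \<and>
     (\<exists>k. \<forall>g x y. (g, x) \<in> C \<longrightarrow> y \<in> X \<longrightarrow> agree k x y \<longrightarrow> (g, y) \<in> C)}"

lemma window_setsI:
  "C \<subseteq> H \<times> X \<Longrightarrow> (\<And>g x y. (g, x) \<in> C \<Longrightarrow> y \<in> X \<Longrightarrow> agree k x y \<Longrightarrow> (g, y) \<in> C) \<Longrightarrow>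
   C \<in> window_sets H X"
  unfolding window_sets_def by blast

lemma window_setsE:
  assumes "C \<in> window_sets H X"
  obtains k where "C \<subseteq> H \<times> X" "\<And>g x y. (g, x) \<in> C \<Longrightarrow> y \<in> X \<Longrightarrow> agree k x y \<Longrightarrow> (g, y) \<in> C"
  using assms unfolding window_sets_def by blast

lemma algebra_window_sets: "algebra (H \<times> X) (window_sets H X)"
  unfolding algebra_iff_Un
proof (intro conjI ballI)
  show "window_sets H X \<subseteq> Pow (H \<times> X)" by (auto simp: window_sets_def)
  show "{} \<in> window_sets H X" by (rule window_setsI) auto
next
  fix C assume "C \<in> window_sets H X"
  then obtain k where "C \<subseteq> H \<times> X" "\<And>g x y. (g, x) \<in> C \<Longrightarrow> y \<in> X \<Longrightarrow> agree k x y \<Longrightarrow> (g, y) \<in> C"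
    by (rule window_setsE) blast
  then show "H \<times> X - C \<in> window_sets H X"
    by (intro window_setsI[where k = k]) (auto dest: agree_sym)
next
  fix C D assume CD: "C \<in> window_sets H X" "D \<in> window_sets H X"
  obtain k where k: "C \<subseteq> H \<times> X" "\<And>g x y. (g, x) \<in> C \<Longrightarrow> y \<in> X \<Longrightarrow> agree k x y \<Longrightarrow> (g, y) \<in> C"
    using CD(1) by (rule window_setsE) blast
  obtain l where l: "D \<subseteq> H \<times> X" "\<And>g x y. (g, x) \<in> D \<Longrightarrow> y \<in> X \<Longrightarrow> agree l x y \<Longrightarrow> (g, y) \<in> D"
    using CD(2) by (rule window_setsE) blast
  show "C \<union> D \<in> window_sets H X"
  proof (rule window_setsI[where k = "max k l"])
    fix g x y assume gx: "(g, x) \<in> C \<union> D" and y: "y \<in> X" and xy: "agree (max k l) x y"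
    have "agree k x y" "agree l x y" using xy by (auto intro: agree_mono)
    then show "(g, y) \<in> C \<union> D" using gx k(2)[OF _ y] l(2)[OF _ y] by blast
  qed (use k l in auto)
qed

section \<open>Topology and Borel sets of the skew product\<close>

context
  fixes G :: "('g, 'm) monoid_scheme" and X :: "(int \<Rightarrow> 'a::finite) set"
begin

lemma topspace_skew: "topspace (skew_topology G X) = carrier G \<times> X"
  by (simp add: skew_topology_def full_shift_topology_def)

lemma openin_window_set:
  assumes "C \<in> window_sets (carrier G) X"
  shows "openin (skew_topology G X) C"
  using assms
proof (rule window_setsE)
  fix k assume C: "C \<subseteq> carrier G \<times> X"
    "\<And>g x y. (g, x) \<in> C \<Longrightarrow> y \<in> X \<Longrightarrow> agree k x y \<Longrightarrow> (g, y) \<in> C"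
  show ?thesis
    unfolding skew_topology_def openin_prod_topology_alt
  proof (intro allI impI)
    fix g x assume gx: "(g, x) \<in> C"
    have "openin (subtopology full_shift_topology X) ({y. agree k x y} \<inter> X)"
      unfolding openin_subtopology using openin_agree by blast
    moreover have "openin (discrete_topology (carrier G)) {g}" using gx C(1) by auto
    moreover have "x \<in> {y. agree k x y} \<inter> X" using gx C(1) by (auto simp: agree_def)
    moreover have "{g} \<times> ({y. agree k x y} \<inter> X) \<subseteq> C" using gx C(2) by auto
    ultimately show "\<exists>U V. openin (discrete_topology (carrier G)) U \<and>
        openin (subtopology full_shift_topology X) V \<and> g \<in> U \<and> x \<in> V \<and> U \<times> V \<subseteq> C"
      by blast
  qed
qed

lemma closedin_window_set:
  assumes "C \<in> window_sets (carrier G) X"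
  shows "closedin (skew_topology G X) C"
proof -
  interpret algebra "carrier G \<times> X" "window_sets (carrier G) X" by (rule algebra_window_sets)
  show ?thesis
    unfolding closedin_def topspace_skew
    using assms sets_into_space by (auto intro: openin_window_set)
qed

text \<open>\<open>W k\<close> consists of the points whose whole \<open>k\<close>-neighbourhood in
  the fibre lies in \<open>U\<close>; openness lets these sets exhaust \<open>U\<close>.
  Countability of the union is what makes window sets generate the Borel sets.\<close>

lemma openin_skew_UN_window_sets:
  assumes U: "openin (skew_topology G X) U"
  shows "\<exists>W :: nat \<Rightarrow> _. range W \<subseteq> window_sets (carrier G) X \<and> U = (\<Union>k. W k)"
proof -
  define W where
    "W k = {(g, x). (g, x) \<in> carrier G \<times> X \<and> (\<forall>y\<in>X. agree k x y \<longrightarrow> (g, y) \<in> U)}" for k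
  have "W k \<in> window_sets (carrier G) X" for k
    by (rule window_setsI[where k = k]) (auto simp: W_def intro: agree_trans)
  moreover have "W k \<subseteq> U" for k
    by (auto simp: W_def agree_def)
  moreover have "\<exists>k. (g, x) \<in> W k" if gx: "(g, x) \<in> U" for g x
  proof -
    obtain A V where AV: "openin (subtopology full_shift_topology X) V" "g \<in> A" "x \<in> V" "A \<times> V \<subseteq> U"
      using U gx unfolding skew_topology_def openin_prod_topology_alt by metis
    obtain V' where V': "openin full_shift_topology V'" "V = V' \<inter> X"
      using AV(1) unfolding openin_subtopology by blast
    obtain k where k: "\<And>y. agree k x y \<Longrightarrow> y \<in> V'"
      using openin_full_shift_agree[OF V'(1)] AV(3) V'(2) by blast
    have "(g, x) \<in> carrier G \<times> X"
      using openin_subset[OF U] gx unfolding topspace_skew by blast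
    then have "(g, x) \<in> W k" unfolding W_def using k V'(2) AV(2,4) by blast
    then show ?thesis ..
  qed
  ultimately have "range W \<subseteq> window_sets (carrier G) X \<and> U = (\<Union>k. W k)" by fastforce
  then show ?thesis by blast
qed

lemma sets_borel_skew:
  "sets (borel_of (skew_topology G X)) = sigma_sets (carrier G \<times> X) (window_sets (carrier G) X)"
proof -
  let ?\<Sigma> = "sigma_sets (carrier G \<times> X) (window_sets (carrier G) X)"
  have "sets (borel_of (skew_topology G X)) = sigma_sets (carrier G \<times> X) {U. openin (skew_topology G X) U}"
    unfolding borel_of_def
    using openin_subset[of "skew_topology G X"] by (simp add: topspace_skew subset_iff Pow_def)
  also have "\<dots> = ?\<Sigma>"
  proof (rule sigma_sets_eqI)
    fix U assume "U \<in> {U. openin (skew_topology G X) U}"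
    then obtain W :: "nat \<Rightarrow> _" where W: "range W \<subseteq> window_sets (carrier G) X" "U = (\<Union>k. W k)"
      using openin_skew_UN_window_sets by blast
    show "U \<in> ?\<Sigma>" unfolding W(2) using W(1) by (intro sigma_sets.Union) auto
  next
    fix C assume "C \<in> window_sets (carrier G) X"
    then show "C \<in> sigma_sets (carrier G \<times> X) {U. openin (skew_topology G X) U}"
      by (auto intro: openin_window_set)
  qed
  finally show ?thesis .
qed

lemma compact_space_skew:
  assumes "finite (carrier G)" "shift_space X"
  shows "compact_space (skew_topology G X)"
proof -
  have "compact_space (full_shift_topology :: (int \<Rightarrow> 'a) topology)"
    unfolding full_shift_topology_def by (simp add: compact_space_product_topology compact_space_discrete_topology)
  moreover have "closedin full_shift_topology X" using assms(2) by (simp add: shift_space_def)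
  ultimately have "compact_space (subtopology full_shift_topology X)"
    by (intro compact_space_subtopology closedin_compact_space)
  then show ?thesis
    unfolding skew_topology_def using assms(1)
    by (simp add: compact_space_prod_topology compact_space_discrete_topology)
qed

end

section \<open>Recurrence and convergence of averages in the skew product\<close>

context dendric_skew_product
begin

lemma skew_map_pow:
  assumes "g \<in> carrier G"
  shows "(skew_map G \<phi> ^^ n) (g, x) = (g \<otimes> \<phi> (factor x 0 (int n)), \<lambda>i. x (i + int n))"
proof (induction n)
  case 0
  then show ?case using assms by (simp add: phi_Nil)
next
  case (Suc n)
  have "factor x 0 (int (Suc n)) = factor x 0 (int n) @ [x (int n)]"
    using factor_snoc[of 0 "int (Suc n)" x] by simp
  then show ?case
    using Suc assms by (simp add: skew_map_def shift_map_def phi_append m_assoc algebra_simps)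
qed

lemma skew_map_funcset: "skew_map G \<phi> \<in> carrier G \<times> X \<rightarrow> carrier G \<times> X"
  using shift_map_in[OF shiftX] by (auto simp: skew_map_def)

lemma skew_map_preimage:
  assumes "C \<in> window_sets (carrier G) X"
  shows "skew_map G \<phi> -` C \<inter> carrier G \<times> X \<in> window_sets (carrier G) X"
  using assms
proof (rule window_setsE)
  fix k assume C: "C \<subseteq> carrier G \<times> X"
    "\<And>g x y. (g, x) \<in> C \<Longrightarrow> y \<in> X \<Longrightarrow> agree k x y \<Longrightarrow> (g, y) \<in> C"
  show ?thesis
  \<comment> \<open>One more coordinate on the right accounts for the shift, and it ensures that the
    letter at \<open>0\<close> read by \<open>\<phi>\<close> is seen even for
    \<open>k = 0\<close>.\<close>
  proof (rule window_setsI[where k = "k + 1"])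
    fix g x y assume gx: "(g, x) \<in> skew_map G \<phi> -` C \<inter> carrier G \<times> X" and y: "y \<in> X"
      and xy: "agree (k + 1) x y"
    have "x 0 = y 0" "agree k (shift_map x) (shift_map y)"
      using xy by (auto simp: agree_def shift_map_def)
    then show "(g, y) \<in> skew_map G \<phi> -` C \<inter> carrier G \<times> X"
      using gx y C(2)[of _ "shift_map x" "shift_map y"] shift_map_in[OF shiftX y]
      by (auto simp: skew_map_def)
  qed auto
qed

text \<open>The first \<open>n\<close> terms of a Birkhoff sum of a \<open>k\<close>-window set read
  the coordinates from \<open>- k\<close> to \<open>n + k - 1\<close>. The word \<open>v\<close>
  there has length \<open>n + 2 * k\<close>, at most \<open>3 * n\<close>, which explains the factor
  \<open>3\<close>.\<close>

lemma skew_window_recurrence: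
  assumes g: "g \<in> carrier G" "h \<in> carrier G" and xy: "x \<in> X" "y \<in> X" and n: "n \<ge> k" "n \<ge> 1"
  shows "\<exists>i\<le>3 * (K * (K + 1) ^ card (carrier G)) * n. g \<otimes> \<phi> (factor x 0 (int i)) = h \<and>
    (\<forall>t. - int k \<le> t \<longrightarrow> t < int (n + k) \<longrightarrow> x (t + int i) = y t)"
proof -
  define v where "v = factor y (- int k) (- int k + int (n + 2 * k))"
  have len: "length v = n + 2 * k" by (simp add: v_def)
  have v: "v \<in> lang X"
    unfolding v_def using xy(2) by (rule factor_in_lang) simp
  have v0: "v \<noteq> []"
    using n(2) len by (metis add_is_0 list.size(3) not_one_le_zero)
  \<comment> \<open>\<open>v\<close> starts \<open>k\<close> places left of the origin of
    \<open>y\<close>, so the group element to aim for at its start is \<open>h\<close> with those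
    \<open>k\<close> letters undone.\<close>
  define h' where "h' = h \<otimes> inv (\<phi> (factor y (- int k) 0))"
  have h': "h' \<in> carrier G" using g by (simp add: h'_def)
  obtain i where i: "i + length v \<le> K * (K + 1) ^ card (carrier G) * length v"
    "factor x (int i) (int i + int (length v)) = v" "g \<otimes> \<phi> (factor x 0 (int i)) = h'"
    using skew_occurrence[OF g(1) h' xy(1) v v0] by blast
  have eq: "x (int i + int t) = y (- int k + int t)" if "t < n + 2 * k" for t
    using i(2) that unfolding len unfolding v_def factor_eq_iff by blast
  show ?thesis
  proof (intro exI[of _ "i + k"] conjI allI impI)
    have "i + k \<le> K * (K + 1) ^ card (carrier G) * length v" using i(1) len by linarith
    also have "\<dots> \<le> K * (K + 1) ^ card (carrier G) * (3 * n)"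
      using n len by (intro mult_left_mono) auto
    finally show "i + k \<le> 3 * (K * (K + 1) ^ card (carrier G)) * n" by (simp add: mult_ac)
    have "factor x (int i) (int i + int k) = factor y (- int k) (- int k + int k)"
      unfolding factor_eq_iff using eq by simp
    then have "factor x 0 (int (i + k)) = factor x 0 (int i) @ factor y (- int k) 0"
      using factor_append[of 0 "int i" "int (i + k)" x] by simp
    then have "g \<otimes> \<phi> (factor x 0 (int (i + k))) = h' \<otimes> \<phi> (factor y (- int k) 0)"
      using g i(3) by (simp add: phi_append m_assoc[symmetric])
    then show "g \<otimes> \<phi> (factor x 0 (int (i + k))) = h"
      using g by (simp add: h'_def m_assoc)
    fix t assume "- int k \<le> t" "t < int (n + k)"
    then show "x (t + int (i + k)) = y t"
      using eq[of "nat (t + int k)"] by (simp add: algebra_simps)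
  qed
qed

lemma birkhoff_sum_window_set:
  assumes C: "C \<subseteq> carrier G \<times> X" "\<And>g x y. (g, x) \<in> C \<Longrightarrow> y \<in> X \<Longrightarrow> agree k x y \<Longrightarrow> (g, y) \<in> C"
    and h: "h \<in> carrier G" and xy: "x \<in> X" "y \<in> X"
    and eq: "\<And>t. - int k \<le> t \<Longrightarrow> t < int (n + k) \<Longrightarrow> x t = y t"
  shows "birkhoff_sum (skew_map G \<phi>) (indicator C) n (h, x) = birkhoff_sum (skew_map G \<phi>) (indicator C) n (h, y)"
  unfolding birkhoff_sum_def
proof (intro sum.cong refl)
  fix j assume j: "j \<in> {..<n}"
  have f: "factor x 0 (0 + int j) = factor y 0 (0 + int j)"
    unfolding factor_eq_iff using eq j by auto
  let ?x = "\<lambda>i. x (i + int j)" and ?y = "\<lambda>i. y (i + int j)"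
  have "agree k ?x ?y" using eq j by (auto simp: agree_def)
  moreover have "?x \<in> X" "?y \<in> X" using shift_space_translate[OF shiftX] xy by auto
  ultimately have "(h \<otimes> \<phi> (factor y 0 (int j)), ?x) \<in> C \<longleftrightarrow> (h \<otimes> \<phi> (factor y 0 (int j)), ?y) \<in> C"
    using C(2) agree_sym by blast
  then show "indicator C ((skew_map G \<phi> ^^ j) (h, x)) = indicator C ((skew_map G \<phi> ^^ j) (h, y))"
    using f h by (simp add: skew_map_pow indicator_def)
qed

lemma skew_averages_converge:
  assumes "C \<in> window_sets (carrier G) X"
  shows "\<exists>c. \<forall>y\<in>carrier G \<times> X. (\<lambda>n. birkhoff_sum (skew_map G \<phi>) (indicator C) n y / n) \<longlonglongrightarrow> c"
  using assms
proof (rule window_setsE)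
  fix k assume C: "C \<subseteq> carrier G \<times> X"
    "\<And>g x y. (g, x) \<in> C \<Longrightarrow> y \<in> X \<Longrightarrow> agree k x y \<Longrightarrow> (g, y) \<in> C"
  \<comment> \<open>The threshold \<open>max k 1\<close> keeps the margin \<open>k\<close> below
    \<open>n\<close>, so that return times are linear in \<open>n\<close>, and makes the word sought
    nonempty.\<close>
  show ?thesis
  proof (rule birkhoff_averages_converge[OF skew_map_funcset,
        where K = "3 * (K * (K + 1) ^ card (carrier G))" and ?n0.0 = "max k 1"])
    show "carrier G \<times> X \<noteq> {}" using shiftX one_closed by (auto simp: shift_space_def)
    fix n y z assume n: "n \<ge> max k 1" and yz: "y \<in> carrier G \<times> X" "z \<in> carrier G \<times> X"
    obtain g x h x' where y: "y = (g, x)" and z: "z = (h, x')" by fastforce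
    have gx: "g \<in> carrier G" "h \<in> carrier G" "x \<in> X" "x' \<in> X" using yz y z by auto
    obtain i where i: "i \<le> 3 * (K * (K + 1) ^ card (carrier G)) * n" "g \<otimes> \<phi> (factor x 0 (int i)) = h"
      "\<And>t. - int k \<le> t \<Longrightarrow> t < int (n + k) \<Longrightarrow> x (t + int i) = x' t"
      using skew_window_recurrence[OF gx, of k n] n by auto
    have "birkhoff_sum (skew_map G \<phi>) (indicator C) n (h, \<lambda>t. x (t + int i))
        = birkhoff_sum (skew_map G \<phi>) (indicator C) n (h, x')"
      by (rule birkhoff_sum_window_set[OF C gx(2) shift_space_translate[OF shiftX gx(3)] gx(4) i(3)])
    then show "\<exists>i\<le>3 * (K * (K + 1) ^ card (carrier G)) * n.
        birkhoff_sum (skew_map G \<phi>) (indicator C) n ((skew_map G \<phi> ^^ i) y)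
        = birkhoff_sum (skew_map G \<phi>) (indicator C) n z"
      using i(1,2) gx(1) by (intro exI[of _ i]) (simp add: y z skew_map_pow)
  qed (auto simp: indicator_def)
qed

lemma uniquely_ergodic_skew: "uniquely_ergodic (skew_topology G X) (skew_map G \<phi>)"
proof (rule uniquely_ergodicI[OF algebra_window_sets])
  show "carrier G \<times> X \<noteq> {}" using shiftX one_closed by (auto simp: shift_space_def)
qed (simp_all only: topspace_skew sets_borel_skew compact_space_skew closedin_window_set fin shiftX
    skew_map_preimage skew_averages_converge skew_map_funcset)

end

section \<open>Application to substitution shifts\<close>

lemma factor_substitution_shift:
  assumes "x \<in> substitution_shift \<sigma>"
  shows "\<exists>n a. sublist (factor x i j) ((\<sigma> ^^ n) [a])"
proof (cases "i \<le> j")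
  case False
  then have "factor x i j = []" by (simp add: factor_def)
  then show ?thesis by auto
qed (use assms in \<open>auto simp: substitution_shift_def\<close>)

theorem theorem8p11:
  fixes X :: "(int \<Rightarrow> 'a::finite) set"
    and \<sigma> :: "'a list \<Rightarrow> 'a list"
    and G :: "('g, 'm) monoid_scheme"
    and \<phi> :: "'a list \<Rightarrow> 'g"
  assumes "dendric_shift X"
    and "substitution \<sigma>"
    and "primitive \<sigma>"
    and "X = substitution_shift \<sigma>"
    and "group G"
    and "finite (carrier G)"
    and "monoid_morphism word_monoid G \<phi>"
    and "\<phi> ` carrier word_monoid = carrier G"
  shows "uniquely_ergodic (skew_topology G X) (skew_map G \<phi>)"
proof -
  obtain p where p: "p \<ge> 1" "\<And>a b. b \<in> set ((\<sigma> ^^ p) [a])"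
    using assms(3) by (auto simp: primitive_def)
  have "X \<noteq> {}" using assms(1) by (simp add: dendric_shift_def shift_space_def)
  then obtain x where x: "x \<in> X" by blast
  interpret S: growing_primitive_substitution \<sigma> p
  proof
    fix k
    \<comment> \<open>Factors of \<open>x\<close> of every length occur in images of letters, so
      these images are unbounded.\<close>
    obtain n a where "sublist (factor x 0 (int k)) ((\<sigma> ^^ n) [a])"
      using factor_substitution_shift x assms(4) by blast
    then show "\<exists>n a. k \<le> length ((\<sigma> ^^ n) [a])"
      using sublist_length_le by fastforce
  qed (use assms(2) p in \<open>auto simp: substitution_def monoid_morphism_def hom_def word_monoid_def\<close>)
  have lang: "\<exists>m a. sublist u ((\<sigma> ^^ m) [a])" if "u \<in> lang X" for u
    using that factor_substitution_shift assms(4) by (auto simp: lang_def)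
  obtain K where K: "\<And>u v. u \<in> lang X \<Longrightarrow> v \<in> lang X \<Longrightarrow> u \<noteq> [] \<Longrightarrow> K * length u \<le> length v \<Longrightarrow> sublist u v"
    using S.linearly_recurrent lang by (elim exE) blast
  interpret group G by (rule assms(5))
  interpret dendric_skew_product G X \<phi> K
  proof
    show "\<phi> u \<in> carrier G" "\<phi> (u @ v) = \<phi> u \<otimes>\<^bsub>G\<^esub> \<phi> v" "\<phi> [] = \<one>\<^bsub>G\<^esub>" for u v
      using assms(7) by (auto simp: monoid_morphism_def hom_def word_monoid_def)
    show "\<exists>u. \<phi> u = g" if "g \<in> carrier G" for g
      using that unfolding assms(8)[symmetric] by blast
  qed (rule assms K; assumption)+
  show ?thesis by (rule uniquely_ergodic_skew)
qed

end
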